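(* Let $F$ be a field of characteristic zero, $V=F^n$, $A\subseteq M_n(F)$ a semisimple subalgebra containing the identity, and $\mathcal G$ the group of units of the centralizer $End_A(V)=\{g\in M_n(F): ga=ag\ \forall a\in A\}$. Then every polynomial function $f:M_n(F)^k\to F$ invariant under simultaneous conjugation by $\mathcal G$ (i.e. $f(gx_1g^{-1},\dots,gx_kg^{-1})=f(x_1,\dots,x_k)$ for all $g\in\mathcal G$) is given by a pure $A$-trace polynomial; that is, the algebra of such invariant functions is generated by the functions $(x_1,\dots,x_k)\mapsto tr(a_1x_{i_1}a_2x_{i_2}\cdots a_mx_{i_m})$ with $a_j\in A$ and $1\le i_j\le k$. *)

theory Defs
  imports "Jordan_Normal_Form.Matrix"
begin

definition mat_tr :: "'a::comm_ring_1 mat \<Rightarrow> 'a" where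
  "mat_tr M = (\<Sum>i<dim_row M. M $$ (i,i))"

definition unital_subalgebra :: "nat \<Rightarrow> 'a::field mat set \<Rightarrow> bool" where
  "unital_subalgebra n A \<longleftrightarrow> A \<subseteq> carrier_mat n n \<and> 0\<^sub>m n n \<in> A \<and> 1\<^sub>m n \<in> A \<and>
     (\<forall>a\<in>A. \<forall>b\<in>A. a + b \<in> A \<and> a * b \<in> A) \<and> (\<forall>c. \<forall>a\<in>A. c \<cdot>\<^sub>m a \<in> A)"

definition alg_ideal :: "nat \<Rightarrow> 'a::field mat set \<Rightarrow> 'a mat set \<Rightarrow> bool" where
  "alg_ideal n A I \<longleftrightarrow> I \<subseteq> A \<and> 0\<^sub>m n n \<in> I \<and>
     (\<forall>x\<in>I. \<forall>y\<in>I. x + y \<in> I) \<and> (\<forall>c. \<forall>x\<in>I. c \<cdot>\<^sub>m x \<in> I) \<and>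
     (\<forall>a\<in>A. \<forall>x\<in>I. a * x \<in> I \<and> x * a \<in> I)"

definition nilpotent_ideal :: "nat \<Rightarrow> 'a::field mat set \<Rightarrow> bool" where
  "nilpotent_ideal n I \<longleftrightarrow> (\<exists>m>0. \<forall>xs. length xs = m \<longrightarrow> set xs \<subseteq> I \<longrightarrow>
       foldr (*) xs (1\<^sub>m n) = 0\<^sub>m n n)"

text \<open>A finite-dimensional algebra is semisimple iff its (Jacobson) radical is zero, i.e. it has
  no nonzero nilpotent two-sided ideal.\<close>
definition semisimple_subalgebra :: "nat \<Rightarrow> 'a::field mat set \<Rightarrow> bool" where
  "semisimple_subalgebra n A \<longleftrightarrow> unital_subalgebra n A \<and>
     (\<forall>I. alg_ideal n A I \<and> nilpotent_ideal n I \<longrightarrow> I = {0\<^sub>m n n})"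

definition centralizer_units :: "nat \<Rightarrow> 'a::field mat set \<Rightarrow> 'a mat set" where
  "centralizer_units n A = {g \<in> carrier_mat n n. invertible_mat g \<and> (\<forall>a\<in>A. g * a = a * g)}"

text \<open>Polynomial functions M_n(F)^k \<rightarrow> F, tuples given as x :: nat \<Rightarrow> 'a mat (entries x 0..x (k-1)):
  the F-algebra generated by the coordinate functions.\<close>
inductive_set poly_funs :: "nat \<Rightarrow> nat \<Rightarrow> ((nat \<Rightarrow> 'a::field mat) \<Rightarrow> 'a) set"
  for n k where
  coord: "i < k \<Longrightarrow> r < n \<Longrightarrow> s < n \<Longrightarrow> (\<lambda>x. x i $$ (r,s)) \<in> poly_funs n k"
| const: "(\<lambda>x. c) \<in> poly_funs n k"
| add: "f \<in> poly_funs n k \<Longrightarrow> g \<in> poly_funs n k \<Longrightarrow> (\<lambda>x. f x + g x) \<in> poly_funs n k"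
| mult: "f \<in> poly_funs n k \<Longrightarrow> g \<in> poly_funs n k \<Longrightarrow> (\<lambda>x. f x * g x) \<in> poly_funs n k"

definition A_word :: "nat \<Rightarrow> ('a::field mat \<times> nat) list \<Rightarrow> (nat \<Rightarrow> 'a mat) \<Rightarrow> 'a mat" where
  "A_word n ps x = foldr (\<lambda>(a,i) M. a * x i * M) ps (1\<^sub>m n)"

inductive_set pure_A_trace_polys :: "nat \<Rightarrow> nat \<Rightarrow> 'a::field mat set \<Rightarrow> ((nat \<Rightarrow> 'a mat) \<Rightarrow> 'a) set"
  for n k A where
  gen: "\<forall>(a,i)\<in>set ps. a \<in> A \<and> i < k \<Longrightarrow> (\<lambda>x. mat_tr (A_word n ps x)) \<in> pure_A_trace_polys n k A"
| const: "(\<lambda>x. c) \<in> pure_A_trace_polys n k A"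
| add: "f \<in> pure_A_trace_polys n k A \<Longrightarrow> g \<in> pure_A_trace_polys n k A \<Longrightarrow> (\<lambda>x. f x + g x) \<in> pure_A_trace_polys n k A"
| mult: "f \<in> pure_A_trace_polys n k A \<Longrightarrow> g \<in> pure_A_trace_polys n k A \<Longrightarrow> (\<lambda>x. f x * g x) \<in> pure_A_trace_polys n k A"

end

theory Submission
  imports Defs "Jordan_Normal_Form.Spectral_Radius"
    "HOL-Library.Function_Algebras" "HOL-Combinatorics.Permutations"
begin

text \<open>
  Semisimplicity in characteristic 0 makes the regular trace form of \<open>A\<close> nondegenerate, so dual
  bases give a separability idempotent \<open>\<Sum>u. u \<otimes> v u\<close> with \<open>\<Sum>u. u (v u) = 1\<close>. Its tensor powers, averaged
  over the symmetric group \<open>S\<close>, form a separability idempotent for the algebra spanned by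
  \<open>A \<otimes> \<dots> \<otimes> A\<close> and \<open>S\<close>, and this yields the double centralizer property: whatever
  commutes with the symmetric tensors in the centralizer of \<open>A\<close> lies in that algebra.
  The full polarization of the leading form of an invariant polynomial consists of multilinear
  invariants, that is, of operators on the tensor power commuting with all \<open>g \<otimes> \<dots> \<otimes> g\<close>; as units are
  dense in the centralizer, these operators commute with all symmetric tensors. The trace of
  \<open>a 0 \<otimes> \<dots> \<otimes> a (d - 1)\<close> composed with a permutation and \<open>x 0 \<otimes> \<dots> \<otimes> x (d - 1)\<close> is the product
  over the cycles of traces of words in the \<open>a\<close> and \<open>x\<close>. Induction on the degree concludes.
\<close>

section \<open>Separability of semisimple algebras in characteristic 0\<close>

text \<open>An explicit separability idempotent takes the place of the Wedderburn decomposition, so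
  neither splitting fields nor simple components of \<open>A\<close> appear. The regular trace form
  is chosen because for it \<open>\<Sum>u. u (v u)\<close> is the unit: pairing that sum with
  \<open>b\<close> gives the trace of left multiplication by \<open>b\<close>. Characteristic 0
  enters in three ways: the trace of a nonzero idempotent is a positive integer, hence not zero;
  \<open>d!\<close> is invertible, both for averaging over \<open>S\<close> and for recovering a
  form from its polarization; and the field is infinite, so some scalar shift of a given matrix is a
  unit. The obstacle on tensor powers is that the elements \<open>\<Sum>u. u E (v u)\<close> of the
  centralizer, with \<open>E\<close> a matrix unit, are usually singular, while invariance is known
  for units only. Polarization therefore serves twice: on the polynomial, and on
  \<open>g \<otimes> \<dots> \<otimes> g\<close>, where it erases the scalar shift. Polynomials are
  kept as lists of monomials, since a function does not display its degree.\<close>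

context vector_space
begin

text \<open>Turns a left ideal of least dimension into one that is minimal for inclusion. The finite
  spanning set \<open>S\<close> makes both bases finite, so that \<open>dim\<close> really measures
  size.\<close>

lemma subspace_eq_if_dim_le:
  assumes W: "subspace W" and "W \<subseteq> V" and "V \<subseteq> span S" "finite S" and "dim V \<le> dim W"
  shows "W = V"
proof -
  obtain B where B: "B \<subseteq> W" "independent B" "W \<subseteq> span B" "card B = dim W"
    by (rule basis_exists)
  obtain C where C: "C \<subseteq> V" "independent C" "V \<subseteq> span C" "card C = dim V"
    by (rule basis_exists)
  have C_fin: "finite C"
    using independent_span_bound[OF \<open>finite S\<close> C(2)] C(1) \<open>V \<subseteq> span S\<close> by auto
  have B_fin: "finite B"
    using independent_span_bound[OF \<open>finite S\<close> B(2)] B(1) \<open>W \<subseteq> V\<close> \<open>V \<subseteq> span S\<close> by auto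
  have "x \<in> W" if "x \<in> V" for x
  proof (rule ccontr)
    assume "x \<notin> W"
    then have "x \<notin> span B"
      using W B(1) span_minimal by blast
    then have "independent (insert x B)" "x \<notin> B"
      using B(2) independent_insertI span_superset by blast+
    moreover have "insert x B \<subseteq> span C"
      using that B(1) \<open>W \<subseteq> V\<close> C(3) by blast
    ultimately have "card (insert x B) \<le> card C"
      using independent_span_bound C_fin by blast
    then show False
      using \<open>x \<notin> B\<close> B_fin B(4) C(4) \<open>dim V \<le> dim W\<close> by simp
  qed
  then show ?thesis using \<open>W \<subseteq> V\<close> by blast
qed

end

lemma sum_fun_apply: "(\<Sum>v\<in>V. F v) w = (\<Sum>v\<in>V. F v w)"
  by (induction V rule: infinite_finite_induct) auto

lemma vector_space_fun: "vector_space (\<lambda>(c::'a::field) (f::'u \<Rightarrow> 'a) x. c * f x)"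
  by unfold_locales (auto simp: fun_eq_iff algebra_simps)

text \<open>Inverts a Gram matrix. Injectivity makes its rows independent, and \<open>card U\<close>
  independent vectors in the span of the \<open>card U\<close> unit vectors span everything; the
  coefficients of the unit vectors form the inverse. For the trace form they give the dual
  basis.\<close>

lemma injective_imp_left_inverse_on:
  fixes b :: "'u \<Rightarrow> 'u \<Rightarrow> 'a::field"
  assumes fin: "finite U"
    and inj: "\<And>f u. (\<And>w. w \<in> U \<Longrightarrow> (\<Sum>u\<in>U. f u * b u w) = 0) \<Longrightarrow> u \<in> U \<Longrightarrow> f u = 0"
  obtains g where "\<And>x w. x \<in> U \<Longrightarrow> w \<in> U \<Longrightarrow> (\<Sum>u\<in>U. g x u * b u w) = (if x = w then 1 else 0)"
proof -
  interpret vector_space "\<lambda>(c::'a) (f::'u \<Rightarrow> 'a) x. c * f x" by (rule vector_space_fun)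
  define r where "r u w = (if w \<in> U then b u w else 0)" for u w
  define d :: "'u \<Rightarrow> 'u \<Rightarrow> 'a" where "d x w = (if w = x then 1 else 0)" for x w
  have r_zero: "f u = 0" if "(\<Sum>u\<in>U. (\<lambda>x. f u * r u x)) = 0" "u \<in> U" for f u
  proof (rule inj[OF _ \<open>u \<in> U\<close>])
    fix w assume "w \<in> U"
    then show "(\<Sum>u\<in>U. f u * b u w) = 0"
      using fun_cong[OF that(1), of w] by (simp add: sum_fun_apply r_def)
  qed
  have r_inj: "inj_on r U"
  proof (rule inj_onI, rule ccontr)
    fix x y assume xy: "x \<in> U" "y \<in> U" "r x = r y" "x \<noteq> y"
    \<comment> \<open>Two equal rows would satisfy the nontrivial relation with coefficients 1 and
      -1.\<close>
    let ?f = "\<lambda>u. if u = x then 1 else if u = y then -1 else (0::'a)"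
    have "(\<Sum>u\<in>U. ?f u * r u w) = (\<Sum>u\<in>{x, y}. ?f u * r u w)" for w
      using xy fin by (intro sum.mono_neutral_right) auto
    also have "\<dots> w = 0" for w
      using xy(3,4) by simp
    finally have "(\<Sum>u\<in>U. (\<lambda>w. ?f u * r u w)) = 0"
      by (simp only: fun_eq_iff sum_fun_apply zero_fun_apply) blast
    from r_zero[OF this xy(1)] show False by simp
  qed
  have indep: "independent (r ` U)"
  proof (rule independent_if_scalars_zero)
    show "finite (r ` U)" using fin by simp
    fix f x assume f: "(\<Sum>x\<in>r ` U. (\<lambda>w. f x * x w)) = 0" and "x \<in> r ` U"
    then obtain u where u: "u \<in> U" "x = r u" by blast
    have "(\<Sum>u\<in>U. (\<lambda>w. f (r u) * r u w)) = 0"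
      using f by (simp only: sum.reindex[OF r_inj] o_def)
    from r_zero[of "\<lambda>u. f (r u)", OF this u(1)] show "f x = 0" by (simp only: u(2))
  qed
  have r_span: "r ` U \<subseteq> span (d ` U)"
  proof (rule image_subsetI)
    fix u
    have "r u = (\<Sum>x\<in>U. (\<lambda>w. r u x * d x w))"
      using fin by (intro ext) (simp add: sum_fun_apply d_def r_def if_distrib[where f = "\<lambda>x. _ * x"] cong: if_cong)
    also have "\<dots> \<in> span (d ` U)"
      by (intro span_sum span_scale span_base) auto
    finally show "r u \<in> span (d ` U)" .
  qed
  have "d x \<in> span (r ` U)" if "x \<in> U" for x
  proof (rule ccontr)
    assume nin: "d x \<notin> span (r ` U)"
    then have "independent (insert (d x) (r ` U))"
      using indep independent_insertI by blast
    moreover have "insert (d x) (r ` U) \<subseteq> span (d ` U)"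
      using r_span that by (auto intro: span_base)
    ultimately have "card (insert (d x) (r ` U)) \<le> card (d ` U)"
      using independent_span_bound fin by blast
    moreover have "d x \<notin> r ` U" using nin span_base by blast
    ultimately show False
      using fin card_image[OF r_inj] card_image_le[OF fin, of d] by simp
  qed
  then have "\<forall>x\<in>U. \<exists>h. d x = (\<Sum>v\<in>r ` U. (\<lambda>w. h v * v w))"
    unfolding span_finite[OF finite_imageI[OF fin, of r]] image_iff by simp
  then obtain h where h: "\<And>x. x \<in> U \<Longrightarrow> d x = (\<Sum>v\<in>r ` U. (\<lambda>w. h x v * v w))"
    by metis
  show ?thesis
  proof (rule that[of "\<lambda>x u. h x (r u)"])
    fix x w assume xw: "x \<in> U" "w \<in> U"
    have "(\<Sum>u\<in>U. h x (r u) * b u w) = (\<Sum>u\<in>U. (\<lambda>w. h x (r u) * r u w)) w"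
      using xw by (simp add: sum_fun_apply r_def)
    also have "(\<Sum>u\<in>U. (\<lambda>w. h x (r u) * r u w)) = d x"
      using h[OF xw(1)] by (simp add: sum.reindex[OF r_inj])
    finally show "(\<Sum>u\<in>U. h x (r u) * b u w) = (if x = w then 1 else 0)"
      by (auto simp: d_def)
  qed
qed

section \<open>Finite-dimensional algebras and the regular trace form\<close>

locale bilinear_algebra = vector_space scale
  for scale :: "'a::field_char_0 \<Rightarrow> 'b::ab_group_add \<Rightarrow> 'b" (infixr "*s" 75) +
  fixes mul :: "'b \<Rightarrow> 'b \<Rightarrow> 'b" (infixl "\<star>" 76)
  assumes mul_add_left: "(x + y) \<star> z = x \<star> z + y \<star> z"
    and mul_add_right: "x \<star> (y + z) = x \<star> y + x \<star> z"
    and mul_scale_left: "(c *s x) \<star> y = c *s (x \<star> y)"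
    and mul_scale_right: "x \<star> (c *s y) = c *s (x \<star> y)"
    and mul_assoc: "(x \<star> y) \<star> z = x \<star> (y \<star> z)"
begin

lemma mul_zero [simp]: "0 \<star> x = 0" "x \<star> 0 = 0"
  using mul_add_left[of 0 0 x] mul_add_right[of x 0 0] by simp_all

lemma mul_diff_left: "(x - y) \<star> z = x \<star> z - y \<star> z"
  using mul_add_left[of "x - y" y z] by simp

lemma mul_sum_left: "sum f S \<star> x = (\<Sum>i\<in>S. f i \<star> x)"
  by (induction S rule: infinite_finite_induct) (auto simp: mul_add_left)

lemma mul_sum_right: "x \<star> sum f S = (\<Sum>i\<in>S. x \<star> f i)"
  by (induction S rule: infinite_finite_induct) (auto simp: mul_add_right)

end

text \<open>\<open>e\<close> is a unit on \<open>A\<close> only: for the product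
  \<open>mmul n\<close> the identity law fails on functions not supported on indices below
  \<open>n\<close>.\<close>

locale unital_fd_algebra = bilinear_algebra scale mul
  for scale :: "'a::field_char_0 \<Rightarrow> 'b::ab_group_add \<Rightarrow> 'b" (infixr "*s" 75)
    and mul (infixl "\<star>" 76) +
  fixes A :: "'b set" and e :: 'b and U :: "'b set"
  assumes subspace_A: "subspace A"
    and closed: "\<And>x y. x \<in> A \<Longrightarrow> y \<in> A \<Longrightarrow> x \<star> y \<in> A"
    and unit_in: "e \<in> A"
    and unit_left: "\<And>x. x \<in> A \<Longrightarrow> e \<star> x = x"
    and unit_right: "\<And>x. x \<in> A \<Longrightarrow> x \<star> e = x"
    and U_subset: "U \<subseteq> A" and U_indep: "independent U" and U_fin: "finite U"
    and U_span: "A \<subseteq> span U"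
begin

abbreviation co :: "'b \<Rightarrow> 'b \<Rightarrow> 'a" where "co \<equiv> representation U"

text \<open>The regular character: the trace of left multiplication by \<open>a\<close> on
  \<open>A\<close>, computed in the basis \<open>U\<close>.\<close>

definition reg :: "'b \<Rightarrow> 'a" where "reg a = (\<Sum>u\<in>U. co (a \<star> u) u)"

lemma expand: "x \<in> A \<Longrightarrow> (\<Sum>u\<in>U. co x u *s u) = x"
  using U_span by (intro sum_representation_eq U_indep U_fin) auto

lemma co_add: "x \<in> A \<Longrightarrow> y \<in> A \<Longrightarrow> co (x + y) u = co x u + co y u"
  using U_span by (subst representation_add[OF U_indep]) auto

lemma co_scale: "x \<in> A \<Longrightarrow> co (c *s x) u = c * co x u"
  using U_span by (subst representation_scale[OF U_indep]) auto

lemma co_sum: "(\<And>t. t \<in> T \<Longrightarrow> g t \<in> A) \<Longrightarrow> co (\<Sum>t\<in>T. f t *s g t) u = (\<Sum>t\<in>T. f t * co (g t) u)"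
  using U_span subspace_A
  by (subst representation_sum[OF U_indep]) (auto simp: co_scale subspace_scale)

lemma reg_sum:
  assumes "\<And>t. t \<in> T \<Longrightarrow> g t \<in> A"
  shows "reg (\<Sum>t\<in>T. f t *s g t) = (\<Sum>t\<in>T. f t * reg (g t))"
proof -
  have "reg (\<Sum>t\<in>T. f t *s g t) = (\<Sum>u\<in>U. \<Sum>t\<in>T. f t * co (g t \<star> u) u)"
    unfolding reg_def using assms U_subset
    by (intro sum.cong refl) (auto simp: mul_sum_left mul_scale_left co_sum closed subset_iff)
  also have "\<dots> = (\<Sum>t\<in>T. f t * reg (g t))"
    by (subst sum.swap) (simp add: reg_def sum_distrib_left)
  finally show ?thesis .
qed

text \<open>Expanding \<open>y \<star> u\<close> in the basis turns \<open>reg (x \<star> y)\<close>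
  into the trace of a product of two matrices, a double sum whose interchange swaps the
  factors.\<close>

lemma reg_commute:
  assumes "a \<in> A" "b \<in> A"
  shows "reg (a \<star> b) = reg (b \<star> a)"
proof -
  have *: "reg (x \<star> y) = (\<Sum>u\<in>U. \<Sum>v\<in>U. co (y \<star> u) v * co (x \<star> v) u)" if "x \<in> A" "y \<in> A" for x y
  proof -
    have "co (x \<star> y \<star> u) u = (\<Sum>v\<in>U. co (y \<star> u) v * co (x \<star> v) u)" if "u \<in> U" for u
    proof -
      have "x \<star> y \<star> u = x \<star> (\<Sum>v\<in>U. co (y \<star> u) v *s v)"
        using that \<open>y \<in> A\<close> U_subset closed by (subst expand) (auto simp: mul_assoc)
      also have "\<dots> = (\<Sum>v\<in>U. co (y \<star> u) v *s (x \<star> v))"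
        by (simp add: mul_sum_right mul_scale_right)
      finally show ?thesis
        using co_sum[of U "\<lambda>v. x \<star> v" "co (y \<star> u)" u] \<open>x \<in> A\<close> U_subset closed by auto
    qed
    then show ?thesis by (simp add: reg_def)
  qed
  show ?thesis
    unfolding *[OF assms] *[OF assms(2,1)] by (subst sum.swap) (simp add: mult.commute)
qed

text \<open>Left multiplication by \<open>p\<close> is a projection onto \<open>W\<close>, so its
  trace is the dimension of \<open>W\<close>, which is nonzero in characteristic 0.\<close>

lemma reg_idempotent:
  assumes p: "p \<in> A" "p \<star> p = p" "p \<noteq> 0"
  shows "reg p \<noteq> 0"
proof -
  define W where "W = {x \<in> A. p \<star> x = x}"
  have W_sub: "subspace W"
    using subspace_A by (auto simp: W_def subspace_def mul_add_right mul_scale_right)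
  obtain B where B: "B \<subseteq> W" "independent B" "W \<subseteq> span B" by (rule basis_exists)
  have B_fin: "finite B"
    using independent_span_bound[OF U_fin B(2)] B(1) U_span by (auto simp: W_def)
  have BA: "B \<subseteq> A" using B(1) by (auto simp: W_def)
  have "p \<in> W" using p by (simp add: W_def)
  then have "B \<noteq> {}" using B(3) p(3) by auto
  have pu: "p \<star> x \<in> W" if "x \<in> A" for x
    using that p closed by (auto simp: W_def simp flip: mul_assoc)
  let ?r = "representation B"
  have exp_B: "(\<Sum>b\<in>B. ?r x b *s b) = x" if "x \<in> W" for x
    using that B by (intro sum_representation_eq B(2) B_fin) auto
  \<comment> \<open>Left multiplication by \<open>p\<close> factors through \<open>W\<close>. Its
    trace equals that of the reverse composition from \<open>W\<close> through \<open>A\<close> back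
    to \<open>W\<close>, which is the identity, so each vector of \<open>B\<close> contributes
    1.\<close>
  have "reg p = (\<Sum>u\<in>U. \<Sum>b\<in>B. ?r (p \<star> u) b * co b u)"
    unfolding reg_def
  proof (rule sum.cong[OF refl])
    fix u assume "u \<in> U"
    then have "p \<star> u = (\<Sum>b\<in>B. ?r (p \<star> u) b *s b)"
      using pu U_subset by (intro exp_B[symmetric]) auto
    then show "co (p \<star> u) u = (\<Sum>b\<in>B. ?r (p \<star> u) b * co b u)"
      using co_sum[of B "\<lambda>b. b"  "?r (p \<star> u)" u] BA by auto
  qed
  also have "\<dots> = (\<Sum>b\<in>B. \<Sum>u\<in>U. co b u * ?r (p \<star> u) b)"
    by (subst sum.swap) (simp add: mult.commute)
  also have "\<dots> = (\<Sum>b\<in>B. 1)"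
  proof (rule sum.cong[OF refl])
    fix b assume b: "b \<in> B"
    have "b = p \<star> (\<Sum>u\<in>U. co b u *s u)"
      using b B(1) by (subst expand) (auto simp: W_def)
    also have "\<dots> = (\<Sum>u\<in>U. co b u *s (p \<star> u))"
      by (simp add: mul_sum_right mul_scale_right)
    finally have "?r b b = ?r (\<Sum>u\<in>U. co b u *s (p \<star> u)) b" by simp
    also have "\<dots> = (\<Sum>u\<in>U. ?r (co b u *s (p \<star> u)) b)"
      using pu U_subset B(3) by (subst representation_sum[OF B(2)]) (auto intro!: span_scale)
    also have "\<dots> = (\<Sum>u\<in>U. co b u * ?r (p \<star> u) b)"
      using pu U_subset B(3) by (intro sum.cong refl) (subst representation_scale[OF B(2)], auto)
    finally show "(\<Sum>u\<in>U. co b u * ?r (p \<star> u) b) = 1"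
      using representation_basis[OF B(2) b] by simp
  qed
  finally show ?thesis using \<open>B \<noteq> {}\<close> B_fin by simp
qed

text \<open>If the radical \<open>R\<close> of the form is nonzero, take a minimal nonzero left
  ideal \<open>L\<close> inside it. By Brauer's argument, either \<open>L\<close> has a nonzero
  idempotent, whose trace is nonzero although it lies in \<open>R\<close>, or \<open>L L = 0\<close>
  and \<open>L\<close> sits in a two-sided ideal of square zero.\<close>

lemma reg_nondegenerate:
  assumes ss: "\<And>I. I \<subseteq> A \<Longrightarrow> subspace I \<Longrightarrow>
      (\<And>a x. a \<in> A \<Longrightarrow> x \<in> I \<Longrightarrow> a \<star> x \<in> I \<and> x \<star> a \<in> I) \<Longrightarrow>
      (\<And>x y. x \<in> I \<Longrightarrow> y \<in> I \<Longrightarrow> x \<star> y = 0) \<Longrightarrow> I \<subseteq> {0}"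
    and a: "a \<in> A" "\<And>b. b \<in> A \<Longrightarrow> reg (a \<star> b) = 0"
  shows "a = 0"
proof (rule ccontr)
  assume "a \<noteq> 0"
  define R where "R = {x \<in> A. \<forall>b\<in>A. reg (x \<star> b) = 0}"
  have A0: "0 \<in> A" and Aadd: "\<And>x y. x \<in> A \<Longrightarrow> y \<in> A \<Longrightarrow> x + y \<in> A"
    and Ascale: "\<And>c x. x \<in> A \<Longrightarrow> c *s x \<in> A"
    using subspace_A by (auto simp: subspace_def)
  have reg0: "reg 0 = 0" using reg_sum[of "{}"] by simp
  have reg_add: "reg (x + y) = reg x + reg y" if "x \<in> A" "y \<in> A" for x y
    using that U_subset by (simp add: reg_def sum.distrib mul_add_left co_add closed subset_iff)
  have reg_scale: "reg (c *s x) = c * reg x" if "x \<in> A" for c x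
    using reg_sum[of "{x}" "\<lambda>x. x" "\<lambda>_. c"] that by simp
  define left where "left L \<longleftrightarrow> L \<subseteq> R \<and> subspace L \<and> (\<forall>a\<in>A. \<forall>x\<in>L. a \<star> x \<in> L) \<and> L \<noteq> {0}" for L
  have "left R"
  proof -
    have "subspace R"
      by (auto simp: R_def subspace_def A0 Aadd Ascale reg0 mul_add_left mul_scale_left reg_add reg_scale closed)
    moreover have "y \<star> x \<in> R" if "y \<in> A" "x \<in> R" for x y
    proof -
      have "reg (y \<star> x \<star> b) = 0" if "b \<in> A" for b
      proof -
        have "reg (y \<star> (x \<star> b)) = reg ((x \<star> b) \<star> y)"
          using that \<open>y \<in> A\<close> \<open>x \<in> R\<close> by (intro reg_commute) (auto simp: R_def closed)
        then show ?thesis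
          using that \<open>y \<in> A\<close> \<open>x \<in> R\<close> by (simp add: mul_assoc R_def closed)
      qed
      then show ?thesis using that by (auto simp: R_def closed)
    qed
    moreover have "R \<noteq> {0}" using a \<open>a \<noteq> 0\<close> by (auto simp: R_def)
    ultimately show ?thesis by (auto simp: left_def)
  qed
  then obtain L where L: "left L" and L_least: "\<And>M. left M \<Longrightarrow> dim L \<le> dim M"
    using ex_has_least_nat[of left R dim] by blast
  have LA: "L \<subseteq> A" and L_sub: "subspace L" and LR: "L \<subseteq> R"
    and L_left: "\<And>a x. a \<in> A \<Longrightarrow> x \<in> L \<Longrightarrow> a \<star> x \<in> L"
    using L by (auto simp: left_def R_def)
  have L_min: "M = L" if "left M" "M \<subseteq> L" for M
    using that L_least[of M] LA U_span U_fin
    by (intro subspace_eq_if_dim_le[of M L U]) (auto simp: left_def)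
  show False
  proof (cases "\<exists>x\<in>L. \<exists>y\<in>L. x \<star> y \<noteq> 0")
    case True
    then obtain z y where zy: "z \<in> L" "y \<in> L" "z \<star> y \<noteq> 0" by blast
    \<comment> \<open>The left ideal \<open>L y\<close> is nonzero and contained in
      \<open>L\<close>, so minimality gives \<open>L y = L\<close> and hence some \<open>p\<close>
      in \<open>L\<close> with \<open>p y = y\<close>.\<close>
    define M where "M = (\<lambda>x. x \<star> y) ` L"
    have "M \<subseteq> L" using LA L_left zy by (auto simp: M_def)
    have "subspace M"
      unfolding subspace_def
    proof (intro conjI ballI allI)
      show "0 \<in> M" using L_sub unfolding M_def by (intro image_eqI[of _ _ 0]) (auto simp: subspace_def)
      show "u + v \<in> M" if "u \<in> M" "v \<in> M" for u v
        using that L_sub unfolding M_def by (auto simp: subspace_def simp flip: mul_add_left)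
      show "c *s u \<in> M" if "u \<in> M" for c u
        using that L_sub unfolding M_def by (auto simp: subspace_def simp flip: mul_scale_left)
    qed
    moreover have "\<forall>a\<in>A. \<forall>x\<in>M. a \<star> x \<in> M"
      using L_left by (auto simp: M_def simp flip: mul_assoc)
    moreover have "M \<noteq> {0}" using zy by (auto simp: M_def)
    ultimately have "left M" using \<open>M \<subseteq> L\<close> LR by (auto simp: left_def)
    then have "y \<in> M" using L_min \<open>M \<subseteq> L\<close> zy by blast
    then obtain p where p: "p \<in> L" "p \<star> y = y" by (auto simp: M_def)
    \<comment> \<open>This left ideal misses \<open>p\<close>, so it is zero by minimality; since it
      contains \<open>p p - p\<close>, the element \<open>p\<close> is idempotent.\<close>
    define K where "K = {x \<in> L. x \<star> y = 0}"
    have "subspace K"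
      using L_sub by (auto simp: K_def subspace_def mul_add_left mul_scale_left)
    moreover have "p \<notin> K" using p zy by (auto simp: K_def)
    moreover have "\<forall>a\<in>A. \<forall>x\<in>K. a \<star> x \<in> K"
      using L_left by (auto simp: K_def mul_assoc)
    moreover have "K \<subseteq> L" by (auto simp: K_def)
    ultimately have "K = {0}"
      using L_min[of K] LR p(1) unfolding left_def by blast
    moreover have "p \<star> p - p \<in> K"
      using p LA L_left L_sub by (auto simp: K_def mul_diff_left mul_assoc subspace_diff)
    ultimately have "p \<star> p = p" by simp
    moreover have "p \<noteq> 0" using p zy by auto
    ultimately have "reg p \<noteq> 0" using p LA reg_idempotent by blast
    moreover have "reg p = 0"
      using p LR unit_in unit_right by (force simp: R_def)
    ultimately show False by simp
  next
    case False
    \<comment> \<open>With \<open>N\<close> the left annihilator of \<open>L\<close>, this is the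
      set of \<open>y\<close> in \<open>N\<close> with \<open>N y = 0\<close>. As \<open>L\<close>
      is a left ideal, \<open>N\<close> is two-sided, and so is \<open>I\<close>; its square lies in
      \<open>N I = 0\<close>, and \<open>L L = 0\<close> puts \<open>L\<close> inside it.\<close>
    define I where "I = {y \<in> A. (\<forall>x\<in>L. y \<star> x = 0) \<and> (\<forall>z\<in>A. (\<forall>x\<in>L. z \<star> x = 0) \<longrightarrow> z \<star> y = 0)}"
    have "I \<subseteq> {0}"
    proof (rule ss)
      show "I \<subseteq> A" by (auto simp: I_def)
      show "subspace I"
        by (auto simp: I_def subspace_def A0 Aadd Ascale mul_add_left mul_scale_left
            mul_add_right mul_scale_right)
      show "x \<star> y = 0" if "x \<in> I" "y \<in> I" for x y
        using that by (auto simp: I_def)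
      show "b \<star> x \<in> I \<and> x \<star> b \<in> I" if "b \<in> A" "x \<in> I" for b x
      proof
        have "z \<star> b \<star> x = 0" if "z \<in> A" "\<forall>x\<in>L. z \<star> x = 0" for z
        proof -
          have "\<forall>x\<in>L. z \<star> b \<star> x = 0"
            using that L_left \<open>b \<in> A\<close> by (auto simp: mul_assoc)
          then show ?thesis
            using \<open>x \<in> I\<close> closed that \<open>b \<in> A\<close> by (auto simp: I_def)
        qed
        then show "b \<star> x \<in> I"
          using that closed by (auto simp: I_def mul_assoc)
        show "x \<star> b \<in> I"
          using that closed L_left by (auto simp: I_def mul_assoc simp flip: mul_assoc[of _ x b])
      qed
    qed
    moreover have "L \<subseteq> I" using False LA by (auto simp: I_def)
    ultimately show False using L L_sub by (auto simp: left_def subspace_def)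
  qed
qed

text \<open>The dual basis with respect to the regular trace form gives a separability idempotent
  \<open>\<Sum>u. u \<otimes> v u\<close>: it is \<open>A\<close>-central because \<open>c a\<close> is at the same time the matrix of left
  multiplication by \<open>a\<close> on the \<open>u\<close> and of right multiplication on the \<open>v u\<close>.\<close>
lemma separability_idempotent:
  assumes ss: "\<And>I. I \<subseteq> A \<Longrightarrow> subspace I \<Longrightarrow>
      (\<And>a x. a \<in> A \<Longrightarrow> x \<in> I \<Longrightarrow> a \<star> x \<in> I \<and> x \<star> a \<in> I) \<Longrightarrow>
      (\<And>x y. x \<in> I \<Longrightarrow> y \<in> I \<Longrightarrow> x \<star> y = 0) \<Longrightarrow> I \<subseteq> {0}"
  obtains v c where "v ` U \<subseteq> A" "(\<Sum>u\<in>U. u \<star> v u) = e"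
    "\<And>a u. a \<in> A \<Longrightarrow> u \<in> U \<Longrightarrow> a \<star> u = (\<Sum>w\<in>U. c a w u *s w)"
    "\<And>a w. a \<in> A \<Longrightarrow> w \<in> U \<Longrightarrow> v w \<star> a = (\<Sum>u\<in>U. c a w u *s v u)"
proof -
  note nondeg = reg_nondegenerate[OF ss]
  have A_sum: "(\<Sum>t\<in>T. f t *s g t) \<in> A" if "\<And>t. t \<in> T \<Longrightarrow> g t \<in> A" for T f and g :: "'b \<Rightarrow> 'b"
    using that subspace_A by (intro subspace_sum subspace_scale) auto
  have UA: "u \<in> A" if "u \<in> U" for u using that U_subset by auto
  \<comment> \<open>Nondegeneracy in usable form: equal traces against the basis force equality. The
    identities of the dual basis below are checked by such pairings.\<close>
  have ext: "x = y" if "x \<in> A" "y \<in> A" "\<And>u. u \<in> U \<Longrightarrow> reg (x \<star> u) = reg (y \<star> u)" for x y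
  proof -
    have *: "reg (x \<star> b) = (\<Sum>u\<in>U. co b u * reg (x \<star> u))" if "x \<in> A" "b \<in> A" for x b
    proof -
      have "reg (x \<star> (\<Sum>u\<in>U. co b u *s u)) = (\<Sum>u\<in>U. co b u * reg (x \<star> u))"
        using reg_sum[of U "\<lambda>u. x \<star> u" "co b"] that UA closed
        by (simp add: mul_sum_right mul_scale_right)
      then show ?thesis using that by (simp add: expand)
    qed
    have reg_diff: "reg (x \<star> b - y \<star> b) = reg (x \<star> b) - reg (y \<star> b)" if "b \<in> A" for b
      using reg_sum[of "{True, False}" "\<lambda>t. if t then x \<star> b else y \<star> b" "\<lambda>t. if t then 1 else -1"]
        that \<open>x \<in> A\<close> \<open>y \<in> A\<close> closed by simp
    have "x - y = 0"
    proof (rule nondeg)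
      show "x - y \<in> A" using that subspace_A by (simp add: subspace_diff)
      fix b assume "b \<in> A"
      then show "reg ((x - y) \<star> b) = 0"
        using that *[of x b] *[of y b] by (simp add: mul_diff_left reg_diff)
    qed
    then show ?thesis by simp
  qed
  have inj: "f u = 0" if "\<And>w. w \<in> U \<Longrightarrow> (\<Sum>u\<in>U. f u * reg (u \<star> w)) = 0" "u \<in> U" for f u
  proof -
    have "(\<Sum>u\<in>U. f u *s u) = 0"
    proof (rule ext)
      fix w assume w: "w \<in> U"
      have "reg ((\<Sum>u\<in>U. f u *s u) \<star> w) = (\<Sum>u\<in>U. f u * reg (u \<star> w))"
        using reg_sum[of U "\<lambda>u. u \<star> w" f] UA w closed by (simp add: mul_sum_left mul_scale_left)
      then show "reg ((\<Sum>u\<in>U. f u *s u) \<star> w) = reg (0 \<star> w)"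
        using that(1)[OF w] reg_sum[of "{}"] by simp
    qed (use A_sum UA subspace_A in \<open>auto simp: subspace_def\<close>)
    then show ?thesis
      using U_indep U_fin that(2) unfolding dependent_finite[OF U_fin] by blast
  qed
  obtain g where g: "\<And>x w. x \<in> U \<Longrightarrow> w \<in> U \<Longrightarrow>
      (\<Sum>u\<in>U. g x u * reg (u \<star> w)) = (if x = w then 1 else 0)"
    by (rule injective_imp_left_inverse_on[OF U_fin, of "\<lambda>u w. reg (u \<star> w)"]) (use inj in blast)+
  define v where "v x = (\<Sum>u\<in>U. g x u *s u)" for x
  have vA: "v x \<in> A" for x
    unfolding v_def by (intro A_sum UA)
  have dual: "reg (v x \<star> w) = (if x = w then 1 else 0)" if "x \<in> U" "w \<in> U" for x w
    using reg_sum[of U "\<lambda>u. u \<star> w" "g x"] UA that closed g[OF that]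
    by (simp add: v_def mul_sum_left mul_scale_left)
  \<comment> \<open>Since \<open>v\<close> is dual to \<open>U\<close>, tracing against
    \<open>v w\<close> reads off the coordinate at \<open>w\<close>.\<close>
  have co_reg: "co b w = reg (v w \<star> b)" if "b \<in> A" "w \<in> U" for b w
  proof -
    have "reg (v w \<star> (\<Sum>u\<in>U. co b u *s u)) = (\<Sum>u\<in>U. co b u * reg (v w \<star> u))"
      using reg_sum[of U "\<lambda>u. v w \<star> u" "co b"] UA vA closed by (simp add: mul_sum_right mul_scale_right)
    also have "\<dots> = (\<Sum>u\<in>U. if w = u then co b u else 0)"
      using that dual by (intro sum.cong) auto
    finally show ?thesis using that U_fin by (simp add: expand)
  qed
  show ?thesis
  proof (rule that[of v "\<lambda>a w u. co (a \<star> u) w"])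
    show "v ` U \<subseteq> A" using vA by auto
    show "a \<star> u = (\<Sum>w\<in>U. co (a \<star> u) w *s w)" if "a \<in> A" "u \<in> U" for a u
      using that UA closed by (simp add: expand)
    show "v w \<star> a = (\<Sum>u\<in>U. co (a \<star> u) w *s v u)" if a: "a \<in> A" and w: "w \<in> U" for a w
    proof (rule ext)
      fix x assume x: "x \<in> U"
      have "reg ((\<Sum>u\<in>U. co (a \<star> u) w *s v u) \<star> x) = (\<Sum>u\<in>U. co (a \<star> u) w * reg (v u \<star> x))"
        using reg_sum[of U "\<lambda>u. v u \<star> x" "\<lambda>u. co (a \<star> u) w"] UA x vA closed
        by (simp add: mul_sum_left mul_scale_left)
      also have "\<dots> = (\<Sum>u\<in>U. if u = x then co (a \<star> u) w else 0)"
        using x dual by (intro sum.cong) auto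
      also have "\<dots> = reg (v w \<star> a \<star> x)"
        using x w a UA closed U_fin by (simp add: co_reg mul_assoc)
      finally show "reg (v w \<star> a \<star> x) = reg ((\<Sum>u\<in>U. co (a \<star> u) w *s v u) \<star> x)" ..
    qed (use a w vA closed A_sum in auto)
    \<comment> \<open>Paired with \<open>b\<close>, the sum yields the diagonal coordinates of
      \<open>b \<star> u\<close>, that is, the definition of \<open>reg b\<close>.\<close>
    show "(\<Sum>u\<in>U. u \<star> v u) = e"
    proof (rule ext)
      fix b assume b: "b \<in> U"
      have "reg ((\<Sum>u\<in>U. u \<star> v u) \<star> b) = (\<Sum>u\<in>U. reg (u \<star> (v u \<star> b)))"
        using reg_sum[of U "\<lambda>u. u \<star> (v u \<star> b)" "\<lambda>_. 1"] b UA vA closed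
        by (simp add: mul_sum_left mul_assoc)
      also have "\<dots> = (\<Sum>u\<in>U. reg (v u \<star> (b \<star> u)))"
        using b UA vA closed by (intro sum.cong refl) (subst reg_commute, auto simp: mul_assoc)
      also have "\<dots> = reg b"
        using b UA closed by (simp add: reg_def co_reg)
      finally show "reg ((\<Sum>u\<in>U. u \<star> v u) \<star> b) = reg (e \<star> b)"
        using b UA unit_left by simp
    qed (use unit_in A_sum[of U "\<lambda>u. u \<star> v u" "\<lambda>_. 1"] UA vA closed in auto)
  qed
qed

end

section \<open>Double centralizers on tensor powers\<close>

text \<open>Row and column indices have arbitrary types, so one vector space structure serves both
  matrices and operators on the tensor power.\<close>

definition scale2 :: "'a::field \<Rightarrow> ('r \<Rightarrow> 's \<Rightarrow> 'a) \<Rightarrow> 'r \<Rightarrow> 's \<Rightarrow> 'a" where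
  "scale2 c f = (\<lambda>r s. c * f r s)"

lemma scale2_apply [simp]: "scale2 c f r s = c * f r s"
  by (simp add: scale2_def)

interpretation kernel: vector_space scale2
  by unfold_locales (auto simp: fun_eq_iff algebra_simps)

text \<open>Cut off outside \<open>R\<close>, so that operators on \<open>R\<close> that agree are
  equal as functions.\<close>

definition kmul :: "'r set \<Rightarrow> ('r \<Rightarrow> 'r \<Rightarrow> 'a::field) \<Rightarrow> ('r \<Rightarrow> 'r \<Rightarrow> 'a) \<Rightarrow> 'r \<Rightarrow> 'r \<Rightarrow> 'a" where
  "kmul R S T r s = (if r \<in> R \<and> s \<in> R then \<Sum>t\<in>R. S r t * T t s else 0)"

text \<open>Composing \<open>T p\<^sub>j \<otimes> q\<^sub>j = p\<^sub>j \<otimes> q\<^sub>j T\<close> (summed over \<open>j\<close>) with a linear projection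
  \<open>\<pi>\<close> onto \<open>B\<close> in the second factor and multiplying the factors
  gives \<open>T = \<Sum>j. p\<^sub>j \<pi>(q\<^sub>j T)\<close>.\<close>
lemma double_centralizer:
  fixes T :: "'r \<Rightarrow> 'r \<Rightarrow> 'a::field" and p q :: "'j \<Rightarrow> 'r \<Rightarrow> 'r \<Rightarrow> 'a"
  assumes sub: "kernel.subspace B"
    and q: "\<And>j. j \<in> J \<Longrightarrow> q j \<in> B"
    and q_supp: "\<And>j r s. j \<in> J \<Longrightarrow> \<not> (r \<in> R \<and> s \<in> R) \<Longrightarrow> q j r s = 0"
    and closed: "\<And>j b. j \<in> J \<Longrightarrow> b \<in> B \<Longrightarrow> kmul R (p j) b \<in> B"
    and unit: "\<And>r s. r \<in> R \<Longrightarrow> s \<in> R \<Longrightarrow>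
      (\<Sum>j\<in>J. \<Sum>t\<in>R. p j r t * q j t s) = (if r = s then 1 else 0)"
    and comm: "\<And>r s a b. r \<in> R \<Longrightarrow> s \<in> R \<Longrightarrow> a \<in> R \<Longrightarrow> b \<in> R \<Longrightarrow>
      (\<Sum>t\<in>R. T r t * (\<Sum>j\<in>J. p j t a * q j b s)) = (\<Sum>t\<in>R. (\<Sum>j\<in>J. p j r a * q j b t) * T t s)"
    and fin: "finite R"
  shows "(\<lambda>r s. if r \<in> R \<and> s \<in> R then T r s else 0) \<in> B"
proof -
  interpret vector_space_pair "scale2 :: 'a \<Rightarrow> ('r \<Rightarrow> 'r \<Rightarrow> 'a) \<Rightarrow> _" "scale2 :: 'a \<Rightarrow> ('r \<Rightarrow> 'r \<Rightarrow> 'a) \<Rightarrow> _"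
    by unfold_locales
  have "Vector_Spaces.linear scale2 scale2 (\<lambda>f :: 'r \<Rightarrow> 'r \<Rightarrow> 'a. f)"
    by (auto simp: Vector_Spaces.linear_iff kernel.vector_space_axioms)
  \<comment> \<open>A linear left inverse of the identity on \<open>B\<close> with values in
    \<open>B\<close> is the projection needed.\<close>
  from linear_exists_left_inverse_on[OF this sub] obtain \<pi>
    where \<pi>_B: "\<And>f. \<pi> f \<in> B" and \<pi>_lin: "Vector_Spaces.linear scale2 scale2 \<pi>" and \<pi>_id: "\<And>f. f \<in> B \<Longrightarrow> \<pi> f = f"
    by (auto simp: image_subset_iff)
  have \<pi>_sum: "\<pi> (\<Sum>j\<in>J. scale2 (c j) (f j)) = (\<Sum>j\<in>J. scale2 (c j) (\<pi> (f j)))" for c f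
    by (simp add: linear_sum[OF \<pi>_lin] linear_scale[OF \<pi>_lin])
  \<comment> \<open>With \<open>r\<close> and \<open>a\<close> fixed, centrality is an equation
    between kernels in the other two indices with scalar coefficients. So \<open>\<pi>\<close> can
    be applied to it, and it leaves each \<open>q j\<close> alone.\<close>
  have key: "(\<Sum>j\<in>J. scale2 (\<Sum>t\<in>R. T r t * p j t a) (q j)) = (\<Sum>j\<in>J. scale2 (p j r a) (\<pi> (kmul R (q j) T)))"
    if ra: "r \<in> R" "a \<in> R" for r a
  proof -
    have "(\<Sum>j\<in>J. scale2 (\<Sum>t\<in>R. T r t * p j t a) (q j)) = (\<Sum>j\<in>J. scale2 (p j r a) (kmul R (q j) T))"
    proof (intro ext)
      fix b s
      show "(\<Sum>j\<in>J. scale2 (\<Sum>t\<in>R. T r t * p j t a) (q j)) b s = (\<Sum>j\<in>J. scale2 (p j r a) (kmul R (q j) T)) b s"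
      proof (cases "b \<in> R \<and> s \<in> R")
        case True
        have "(\<Sum>j\<in>J. scale2 (\<Sum>t\<in>R. T r t * p j t a) (q j)) b s = (\<Sum>j\<in>J. \<Sum>t\<in>R. T r t * (p j t a * q j b s))"
          by (simp add: sum_fun_apply sum_distrib_right mult.assoc)
        also have "\<dots> = (\<Sum>t\<in>R. T r t * (\<Sum>j\<in>J. p j t a * q j b s))"
          by (subst sum.swap) (simp add: sum_distrib_left)
        also have "\<dots> = (\<Sum>t\<in>R. \<Sum>j\<in>J. p j r a * (q j b t * T t s))"
          using True ra by (subst comm) (auto simp: sum_distrib_right mult.assoc)
        also have "\<dots> = (\<Sum>j\<in>J. scale2 (p j r a) (kmul R (q j) T)) b s"
          using True by (subst sum.swap) (simp add: sum_fun_apply kmul_def sum_distrib_left)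
        finally show ?thesis .
      next
        case False
        then show ?thesis by (auto simp: sum_fun_apply kmul_def q_supp)
      qed
    qed
    from arg_cong[OF this, of \<pi>] show ?thesis
      by (simp add: \<pi>_sum \<pi>_id q)
  qed
  have "(\<lambda>r s. if r \<in> R \<and> s \<in> R then T r s else 0) = (\<Sum>j\<in>J. kmul R (p j) (\<pi> (kmul R (q j) T)))"
  proof (intro ext)
    fix r s
    show "(if r \<in> R \<and> s \<in> R then T r s else 0) = (\<Sum>j\<in>J. kmul R (p j) (\<pi> (kmul R (q j) T))) r s"
    proof (cases "r \<in> R \<and> s \<in> R")
      case True
      \<comment> \<open>The Kronecker delta is about to be replaced by the unit
        \<open>\<Sum>j. p j q j\<close>, multiplied onto \<open>T\<close> from the right.\<close>
      have "T r s = (\<Sum>t\<in>R. if t = s then T r t else 0)"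
        using True fin by simp
      also have "\<dots> = (\<Sum>t\<in>R. T r t * (\<Sum>j\<in>J. \<Sum>a\<in>R. p j t a * q j a s))"
        using True by (intro sum.cong) (auto simp: unit)
      also have "\<dots> = (\<Sum>t\<in>R. \<Sum>j\<in>J. \<Sum>a\<in>R. T r t * p j t a * q j a s)"
        by (simp add: sum_distrib_left mult.assoc)
      also have "\<dots> = (\<Sum>t\<in>R. \<Sum>a\<in>R. \<Sum>j\<in>J. T r t * p j t a * q j a s)"
        by (intro sum.cong refl sum.swap)
      also have "\<dots> = (\<Sum>a\<in>R. \<Sum>t\<in>R. \<Sum>j\<in>J. T r t * p j t a * q j a s)"
        by (rule sum.swap)
      also have "\<dots> = (\<Sum>a\<in>R. \<Sum>j\<in>J. \<Sum>t\<in>R. T r t * p j t a * q j a s)"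
        by (intro sum.cong refl sum.swap)
      also have "\<dots> = (\<Sum>a\<in>R. (\<Sum>j\<in>J. scale2 (\<Sum>t\<in>R. T r t * p j t a) (q j)) a s)"
        by (simp add: sum_fun_apply sum_distrib_right)
      also have "\<dots> = (\<Sum>a\<in>R. \<Sum>j\<in>J. p j r a * \<pi> (kmul R (q j) T) a s)"
        using True key by (intro sum.cong refl) (simp add: sum_fun_apply)
      also have "\<dots> = (\<Sum>j\<in>J. kmul R (p j) (\<pi> (kmul R (q j) T))) r s"
        using True by (subst sum.swap) (simp add: sum_fun_apply kmul_def)
      finally show ?thesis using True by simp
    next
      case False
      then show ?thesis by (auto simp: sum_fun_apply kmul_def)
    qed
  qed
  also have "\<dots> \<in> B"
    by (intro kernel.subspace_sum[OF sub] closed \<pi>_B)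
  finally show ?thesis .
qed

section \<open>Operators on tensor powers and permutations of the factors\<close>

definition mmul :: "nat \<Rightarrow> (nat \<Rightarrow> nat \<Rightarrow> 'a::field) \<Rightarrow> (nat \<Rightarrow> nat \<Rightarrow> 'a) \<Rightarrow> nat \<Rightarrow> nat \<Rightarrow> 'a" where
  "mmul n a b r s = (\<Sum>k<n. a r k * b k s)"

text \<open>Labels of the standard basis of the \<open>d\<close>-th tensor power of
  \<open>F^n\<close>. Extensionality makes labels equal once they agree below
  \<open>d\<close>.\<close>

definition multi_indices :: "nat \<Rightarrow> nat \<Rightarrow> (nat \<Rightarrow> nat) set" where
  "multi_indices n d = PiE {..<d} (\<lambda>_. {..<n})"

text \<open>The matrix of \<open>a 0 \<otimes> \<dots> \<otimes> a (d - 1)\<close> composed with a permutation of the tensor factors.\<close>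
definition tensor_perm :: "nat \<Rightarrow> nat \<Rightarrow> (nat \<Rightarrow> nat) \<Rightarrow> (nat \<Rightarrow> nat \<Rightarrow> nat \<Rightarrow> 'a::field) \<Rightarrow>
    (nat \<Rightarrow> nat) \<Rightarrow> (nat \<Rightarrow> nat) \<Rightarrow> 'a" where
  "tensor_perm n d \<sigma> a r s =
    (if r \<in> multi_indices n d \<and> s \<in> multi_indices n d then \<Prod>j<d. a j (r j) (s (\<sigma> j)) else 0)"

lemma finite_multi_indices [simp]: "finite (multi_indices n d)"
  by (simp add: multi_indices_def finite_PiE)

lemma multi_indices_less: "r \<in> multi_indices n d \<Longrightarrow> j < d \<Longrightarrow> r j < n"
  by (auto simp: multi_indices_def)

lemma sum_multi_indices_prod:
  fixes f :: "nat \<Rightarrow> nat \<Rightarrow> 'a::comm_semiring_1"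
  shows "(\<Sum>r\<in>multi_indices n d. \<Prod>j<d. f j (r j)) = (\<Prod>j<d. \<Sum>k<n. f j k)"
  unfolding multi_indices_def by (rule prod_sum_PiE[symmetric]) auto

lemma prod_permute:
  fixes f :: "nat \<Rightarrow> 'a::comm_monoid_mult"
  assumes "\<sigma> permutes {..<d}"
  shows "(\<Prod>j<d. f (\<sigma> j)) = (\<Prod>j<d. f j)"
  using prod.permute[OF assms, of f] by (simp add: o_def)

lemma perm_less: "\<sigma> permutes {..<d} \<Longrightarrow> j < d \<Longrightarrow> \<sigma> j < (d::nat)"
  using permutes_in_image[of \<sigma> "{..<d}" j] by simp

lemma multi_indices_comp:
  assumes "\<sigma> permutes {..<d}" "r \<in> multi_indices n d"
  shows "r \<circ> \<sigma> \<in> multi_indices n d"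
  unfolding multi_indices_def
proof (rule PiE_I)
  show "(r \<circ> \<sigma>) j \<in> {..<n}" if "j \<in> {..<d}" for j
    using that perm_less[OF assms(1)] multi_indices_less[OF assms(2)] by simp
  show "(r \<circ> \<sigma>) j = undefined" if "j \<notin> {..<d}" for j
    using permutes_not_in[OF assms(1) that] assms(2) that PiE_arb[of r "{..<d}" "\<lambda>_. {..<n}" j]
    by (simp add: multi_indices_def)
qed

text \<open>The idempotent of \<open>double_centralizer\<close> is indexed by a permutation and a
  choice \<open>I\<close> of one basis element per factor. Summing over \<open>I\<close> factorizes,
  and summing over permutations symmetrizes; this is why commuting with symmetric tensors of the
  centralizer suffices.\<close>

lemma tensor_double_centralizer:
  fixes A :: "(nat \<Rightarrow> nat \<Rightarrow> 'a::field_char_0) set" and n d :: nat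
  defines "R \<equiv> multi_indices n d"
  assumes mul: "\<And>a b. a \<in> A \<Longrightarrow> b \<in> A \<Longrightarrow> mmul n a b \<in> A"
    and U: "finite U" "U \<subseteq> A" "v ` U \<subseteq> A"
    and unit: "\<And>r s. r < n \<Longrightarrow> s < n \<Longrightarrow> (\<Sum>u\<in>U. mmul n u (v u) r s) = (if r = s then 1 else 0)"
    and central: "\<And>a x y r s. a \<in> A \<Longrightarrow> x < n \<Longrightarrow> y < n \<Longrightarrow> r < n \<Longrightarrow> s < n \<Longrightarrow>
      mmul n a (\<lambda>r s. \<Sum>u\<in>U. u r x * v u y s) r s = mmul n (\<lambda>r s. \<Sum>u\<in>U. u r x * v u y s) a r s"
    and comm: "\<And>c r s. (\<And>j a r s. j < d \<Longrightarrow> a \<in> A \<Longrightarrow> r < n \<Longrightarrow> s < n \<Longrightarrow> mmul n a (c j) r s = mmul n (c j) a r s) \<Longrightarrow>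
      r \<in> R \<Longrightarrow> s \<in> R \<Longrightarrow>
      (\<Sum>t\<in>R. T r t * (\<Sum>\<sigma> | \<sigma> permutes {..<d}. \<Prod>j<d. c (\<sigma> j) (t j) (s j))) =
      (\<Sum>t\<in>R. (\<Sum>\<sigma> | \<sigma> permutes {..<d}. \<Prod>j<d. c (\<sigma> j) (r j) (t j)) * T t s)"
  shows "(\<lambda>r s. if r \<in> R \<and> s \<in> R then T r s else 0) \<in>
    kernel.span {tensor_perm n d \<sigma> a |\<sigma> a. \<sigma> permutes {..<d} \<and> (\<forall>j<d. a j \<in> A)}"
    (is "_ \<in> kernel.span ?G")
proof -
  define S where "S = {\<sigma>. \<sigma> permutes {..<d}}"
  define P where "P = PiE {..<d} (\<lambda>_. U)"
  \<comment> \<open>\<open>p\<close> reads its row index and \<open>q\<close> its column index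
    through the same \<sigma>, so the permutations cancel in the product; the factor
    \<open>1 / fact d\<close> turns the sum over \<sigma> into an average.\<close>
  define p :: "(nat \<Rightarrow> nat) \<times> (nat \<Rightarrow> nat \<Rightarrow> nat \<Rightarrow> 'a) \<Rightarrow> (nat \<Rightarrow> nat) \<Rightarrow> (nat \<Rightarrow> nat) \<Rightarrow> 'a"
    where "p = (\<lambda>(\<sigma>, I) r s. \<Prod>j<d. I j (r (\<sigma> j)) (s j))"
  define q :: "(nat \<Rightarrow> nat) \<times> (nat \<Rightarrow> nat \<Rightarrow> nat \<Rightarrow> 'a) \<Rightarrow> (nat \<Rightarrow> nat) \<Rightarrow> (nat \<Rightarrow> nat) \<Rightarrow> 'a"
    where "q = (\<lambda>(\<sigma>, I). scale2 (1 / fact d) (tensor_perm n d \<sigma> (\<lambda>j. v (I j))))"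
  have S_fin: "finite S" and S_card: "card S = fact d"
    by (auto simp: S_def finite_permutations card_permutations[of "{..<d}" d])
  have R_less: "r j < n" if "r \<in> R" "j < d" for r j
    using that by (auto simp: R_def multi_indices_less)
  have P_A: "I j \<in> A" "v (I j) \<in> A" if "I \<in> P" "j < d" for I j
    using that U by (auto simp: P_def)
  have sum_P: "(\<Sum>I\<in>P. \<Prod>j<d. f j (I j)) = (\<Prod>j<d. \<Sum>u\<in>U. f j u)" for f :: "nat \<Rightarrow> _ \<Rightarrow> 'a"
    unfolding P_def using U by (intro prod_sum_PiE[symmetric]) auto
  note sum_R = sum_multi_indices_prod[where n = n and d = d, folded R_def]
  have pq: "(\<Sum>j\<in>S \<times> P. p j t a * q j b s) =
      (1 / fact d) * (\<Sum>\<sigma>\<in>S. \<Prod>j<d. \<Sum>u\<in>U. u (t (\<sigma> j)) (a j) * v u (b j) (s (\<sigma> j)))"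
    if "b \<in> R" "s \<in> R" for t a b s
  proof -
    have "p (\<sigma>, I) t a * q (\<sigma>, I) b s = (1 / fact d) * (\<Prod>j<d. I j (t (\<sigma> j)) (a j) * v (I j) (b j) (s (\<sigma> j)))" for \<sigma> I
      using that by (simp add: p_def q_def tensor_perm_def R_def prod.distrib)
    then have "(\<Sum>j\<in>S \<times> P. p j t a * q j b s) =
        (1 / fact d) * (\<Sum>\<sigma>\<in>S. \<Sum>I\<in>P. \<Prod>j<d. I j (t (\<sigma> j)) (a j) * v (I j) (b j) (s (\<sigma> j)))"
      by (simp only: sum.cartesian_product' sum_distrib_left)
    also have "(\<Sum>\<sigma>\<in>S. \<Sum>I\<in>P. \<Prod>j<d. I j (t (\<sigma> j)) (a j) * v (I j) (b j) (s (\<sigma> j))) =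
        (\<Sum>\<sigma>\<in>S. \<Prod>j<d. \<Sum>u\<in>U. u (t (\<sigma> j)) (a j) * v u (b j) (s (\<sigma> j)))"
      by (intro sum.cong refl sum_P)
    finally show ?thesis .
  qed
  show ?thesis
  proof (rule double_centralizer[where J = "S \<times> P" and p = p and q = q and R = R and T = T and B = "kernel.span ?G"])
    show "kernel.subspace (kernel.span ?G)" by (rule kernel.subspace_span)
    show "finite R" by (simp add: R_def)
    show "q j \<in> kernel.span ?G" if j: "j \<in> S \<times> P" for j
    proof -
      obtain \<sigma> I where \<sigma>I: "j = (\<sigma>, I)" "\<sigma> permutes {..<d}" "I \<in> P"
        using j by (auto simp: S_def)
      then have "tensor_perm n d \<sigma> (\<lambda>j. v (I j)) \<in> ?G" using P_A by blast
      then show ?thesis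
        by (simp add: q_def \<sigma>I(1) kernel.span_scale kernel.span_base)
    qed
    show "q j r s = 0" if "\<not> (r \<in> R \<and> s \<in> R)" for j r s
      by (cases j) (use that in \<open>auto simp: q_def tensor_perm_def R_def\<close>)
    show "kmul R (p j) b \<in> kernel.span ?G" if j: "j \<in> S \<times> P" and b: "b \<in> kernel.span ?G" for j b
    proof -
      obtain \<sigma> I where \<sigma>I: "j = (\<sigma>, I)" "\<sigma> permutes {..<d}" "I \<in> P"
        using j by (auto simp: S_def)
      have inv: "inv_into UNIV \<sigma> permutes {..<d}" by (rule permutes_inv[OF \<sigma>I(2)])
      have gen: "kmul R (p j) x \<in> kernel.span ?G" if "x \<in> ?G" for x
      proof -
        from that obtain \<tau> a where x: "x = tensor_perm n d \<tau> a"
          and \<tau>: "\<tau> permutes {..<d}" and a: "\<And>j. j < d \<Longrightarrow> a j \<in> A" by blast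
        \<comment> \<open>Reindexing the factors by the inverse of \<sigma> restores the row order
          and moves the permutation to the column index.\<close>
        have "kmul R (p j) x = tensor_perm n d (\<tau> \<circ> inv_into UNIV \<sigma>) (\<lambda>i. mmul n (I (inv_into UNIV \<sigma> i)) (a (inv_into UNIV \<sigma> i)))"
        proof (intro ext)
          fix r s
          show "kmul R (p j) x r s = tensor_perm n d (\<tau> \<circ> inv_into UNIV \<sigma>) (\<lambda>i. mmul n (I (inv_into UNIV \<sigma> i)) (a (inv_into UNIV \<sigma> i))) r s"
          proof (cases "r \<in> R \<and> s \<in> R")
            case True
            then have "kmul R (p j) x r s = (\<Sum>t\<in>R. \<Prod>j<d. I j (r (\<sigma> j)) (t j) * a j (t j) (s (\<tau> j)))"
              by (simp add: kmul_def p_def \<sigma>I x tensor_perm_def R_def prod.distrib)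
            also have "\<dots> = (\<Prod>j<d. mmul n (I j) (a j) (r (\<sigma> j)) (s (\<tau> j)))"
              unfolding mmul_def by (rule sum_R)
            also have "\<dots> = (\<Prod>i<d. mmul n (I (inv_into UNIV \<sigma> i)) (a (inv_into UNIV \<sigma> i)) (r (\<sigma> (inv_into UNIV \<sigma> i))) (s (\<tau> (inv_into UNIV \<sigma> i))))"
              by (rule prod_permute[OF inv, of "\<lambda>j. mmul n (I j) (a j) (r (\<sigma> j)) (s (\<tau> j))", symmetric])
            also have "\<dots> = tensor_perm n d (\<tau> \<circ> inv_into UNIV \<sigma>) (\<lambda>i. mmul n (I (inv_into UNIV \<sigma> i)) (a (inv_into UNIV \<sigma> i))) r s"
              using True by (simp add: tensor_perm_def R_def permutes_inverses(1)[OF \<sigma>I(2)])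
            finally show ?thesis .
          next
            case False
            then show ?thesis by (auto simp: kmul_def tensor_perm_def R_def)
          qed
      qed
        moreover have "\<tau> \<circ> inv_into UNIV \<sigma> permutes {..<d}"
          using inv \<tau> by (rule permutes_compose)
        moreover have "mmul n (I (inv_into UNIV \<sigma> i)) (a (inv_into UNIV \<sigma> i)) \<in> A" if "i < d" for i
          using that inv \<sigma>I(3) by (intro mul P_A a) (auto simp: perm_less)
        ultimately have "kmul R (p j) x \<in> ?G" by blast
        then show ?thesis by (rule kernel.span_base)
      qed
      have "kmul R (p j) 0 = 0" by (intro ext) (simp add: kmul_def)
      moreover have "kmul R (p j) (x + y) = kmul R (p j) x + kmul R (p j) y" for x y
        by (intro ext) (simp add: kmul_def distrib_left sum.distrib)
      moreover have "kmul R (p j) (scale2 c x) = scale2 c (kmul R (p j) x)" for c x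
        by (intro ext) (simp add: kmul_def sum_distrib_left mult.left_commute)
      ultimately have "kernel.subspace {b. kmul R (p j) b \<in> kernel.span ?G}"
        by (simp add: kernel.subspace_def kernel.span_zero kernel.span_add kernel.span_scale)
      then have "kernel.span ?G \<subseteq> {b. kmul R (p j) b \<in> kernel.span ?G}"
        using gen by (intro kernel.span_minimal) auto
      then show ?thesis using b by blast
    qed
    show "(\<Sum>j\<in>S \<times> P. \<Sum>t\<in>R. p j r t * q j t s) = (if r = s then 1 else 0)" if rs: "r \<in> R" "s \<in> R" for r s
    proof -
      have *: "(\<Prod>j<d. m (\<sigma> j)) = (if r = s then 1 else 0)"
        if "\<sigma> permutes {..<d}" and "\<And>j. j < d \<Longrightarrow> m j = (if r j = s j then 1 else 0)" for \<sigma> and m :: "nat \<Rightarrow> 'a"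
      proof (cases "r = s")
        case True
        then show ?thesis using that(2) prod_permute[OF that(1), of m] by simp
      next
        case False
        then obtain i where "i < d" "r i \<noteq> s i"
          using rs PiE_ext[of r "{..<d}" "\<lambda>_. {..<n}" s] by (auto simp: R_def multi_indices_def)
        then have "(\<Prod>j<d. m j) = 0" using that(2) by (intro prod_zero) auto
        then show ?thesis using False prod_permute[OF that(1), of m] by simp
      qed
      have "(\<Sum>j\<in>S \<times> P. \<Sum>t\<in>R. p j r t * q j t s) = (\<Sum>t\<in>R. \<Sum>j\<in>S \<times> P. p j r t * q j t s)"
        by (rule sum.swap)
      also have "\<dots> = (\<Sum>t\<in>R. (1 / fact d) * (\<Sum>\<sigma>\<in>S. \<Prod>j<d. \<Sum>u\<in>U. u (r (\<sigma> j)) (t j) * v u (t j) (s (\<sigma> j))))"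
        using rs by (intro sum.cong refl pq)
      also have "\<dots> = (1 / fact d) * (\<Sum>\<sigma>\<in>S. \<Sum>t\<in>R. \<Prod>j<d. \<Sum>u\<in>U. u (r (\<sigma> j)) (t j) * v u (t j) (s (\<sigma> j)))"
        by (subst sum.swap) (simp add: sum_distrib_left)
      also have "\<dots> = (1 / fact d) * (\<Sum>\<sigma>\<in>S. if r = s then 1 else 0)"
      proof (intro arg_cong[where f = "(*) _"] sum.cong refl)
        fix \<sigma> assume "\<sigma> \<in> S"
        then have \<sigma>: "\<sigma> permutes {..<d}" by (simp add: S_def)
        have "(\<Sum>t\<in>R. \<Prod>j<d. \<Sum>u\<in>U. u (r (\<sigma> j)) (t j) * v u (t j) (s (\<sigma> j))) =
            (\<Prod>j<d. \<Sum>k<n. \<Sum>u\<in>U. u (r (\<sigma> j)) k * v u k (s (\<sigma> j)))"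
          by (rule sum_R)
        also have "\<dots> = (\<Prod>j<d. (\<Sum>u\<in>U. mmul n u (v u) (r (\<sigma> j)) (s (\<sigma> j))))"
          unfolding mmul_def by (intro prod.cong refl sum.swap)
        also have "\<dots> = (if r = s then 1 else 0)"
          using unit R_less rs by (intro *[OF \<sigma>, of "\<lambda>j. \<Sum>u\<in>U. mmul n u (v u) (r j) (s j)"]) auto
        finally show "(\<Sum>t\<in>R. \<Prod>j<d. \<Sum>u\<in>U. u (r (\<sigma> j)) (t j) * v u (t j) (s (\<sigma> j))) = (if r = s then 1 else 0)" .
      qed
      finally show ?thesis by (simp add: S_card)
    qed
    show "(\<Sum>t\<in>R. T r t * (\<Sum>j\<in>S \<times> P. p j t a * q j b s)) = (\<Sum>t\<in>R. (\<Sum>j\<in>S \<times> P. p j r a * q j b t) * T t s)"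
      if "r \<in> R" "s \<in> R" "a \<in> R" "b \<in> R" for r s a b
    proof -
      \<comment> \<open>\<open>c j\<close> is \<open>\<Sum>u. u E (v u)\<close> with
        \<open>E\<close> the matrix unit at \<open>(a j, b j)\<close>. Centrality of the idempotent
        places it in the centralizer of \<open>A\<close>, so \<open>comm\<close> applies to the
        symmetrized tensor of the \<open>c j\<close>.\<close>
      define c where "c j r s = (\<Sum>u\<in>U. u r (a j) * v u (b j) s)" for j r s
      have pq_c: "(\<Sum>j\<in>S \<times> P. p j t a * q j b s) = (1 / fact d) * (\<Sum>\<sigma>\<in>S. \<Prod>j<d. c (\<sigma> j) (t j) (s j))"
        if "s \<in> R" for s t
      proof -
        have "(\<Sum>j\<in>S \<times> P. p j t a * q j b s) = (1 / fact d) * (\<Sum>\<sigma>\<in>S. \<Prod>j<d. c j (t (\<sigma> j)) (s (\<sigma> j)))"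
          using pq[OF \<open>b \<in> R\<close> that] by (simp add: c_def)
        also have "(\<Sum>\<sigma>\<in>S. \<Prod>j<d. c j (t (\<sigma> j)) (s (\<sigma> j))) = (\<Sum>\<sigma>\<in>S. \<Prod>j<d. c (inv_into UNIV \<sigma> j) (t j) (s j))"
        proof (intro sum.cong refl)
          fix \<sigma> assume "\<sigma> \<in> S"
          then have \<sigma>: "\<sigma> permutes {..<d}" by (simp add: S_def)
          show "(\<Prod>j<d. c j (t (\<sigma> j)) (s (\<sigma> j))) = (\<Prod>j<d. c (inv_into UNIV \<sigma> j) (t j) (s j))"
            using prod_permute[OF \<sigma>, of "\<lambda>j. c (inv_into UNIV \<sigma> j) (t j) (s j)"] by (simp add: permutes_inverses(2)[OF \<sigma>])
        qed
        also have "\<dots> = (\<Sum>\<sigma>\<in>S. \<Prod>j<d. c (\<sigma> j) (t j) (s j))"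
          unfolding S_def by (rule sum_permutations_inverse[symmetric])
        finally show ?thesis .
      qed
      have "(\<Sum>t\<in>R. T r t * (\<Sum>\<sigma>\<in>S. \<Prod>j<d. c (\<sigma> j) (t j) (s j))) =
          (\<Sum>t\<in>R. (\<Sum>\<sigma>\<in>S. \<Prod>j<d. c (\<sigma> j) (r j) (t j)) * T t s)"
        unfolding S_def using that
      proof (intro comm)
        fix j x r s assume "j < d" "x \<in> A" "r < n" "s < n"
        then show "mmul n x (c j) r s = mmul n (c j) x r s"
          using central[of x "a j" "b j" r s] that by (simp add: c_def[abs_def] R_less)
      qed
      then have "(1 / fact d) * (\<Sum>t\<in>R. T r t * (\<Sum>\<sigma>\<in>S. \<Prod>j<d. c (\<sigma> j) (t j) (s j))) =
          (1 / fact d) * (\<Sum>t\<in>R. (\<Sum>\<sigma>\<in>S. \<Prod>j<d. c (\<sigma> j) (r j) (t j)) * T t s)" by simp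
      then show ?thesis
        using that by (simp add: pq_c sum_distrib_left mult_ac)
    qed
  qed
qed

section \<open>Traces of tensors composed with permutations\<close>

text \<open>Matrices of all sizes share one type; functions vanishing outside the \<open>n\<close>
  by \<open>n\<close> square live in an honest vector space, which the algebra above
  requires.\<close>

definition mat_fun :: "nat \<Rightarrow> 'a::field mat \<Rightarrow> nat \<Rightarrow> nat \<Rightarrow> 'a" where
  "mat_fun n M r s = (if r < n \<and> s < n then M $$ (r, s) else 0)"

text \<open>Agreement is asked on tuples of \<open>n\<close> by \<open>n\<close> matrices only, as
  in the theorem; this notion is still closed under sums and products.\<close>

definition pure_on :: "nat \<Rightarrow> nat \<Rightarrow> 'a::field mat set \<Rightarrow> ((nat \<Rightarrow> 'a mat) \<Rightarrow> 'a) \<Rightarrow> bool" where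
  "pure_on n k A f \<longleftrightarrow>
    (\<exists>p \<in> pure_A_trace_polys n k A. \<forall>x. (\<forall>i<k. x i \<in> carrier_mat n n) \<longrightarrow> f x = p x)"

lemma pure_on_cong:
  "pure_on n k A f \<Longrightarrow> (\<And>x. (\<And>i. i < k \<Longrightarrow> x i \<in> carrier_mat n n) \<Longrightarrow> g x = f x) \<Longrightarrow> pure_on n k A g"
  unfolding pure_on_def by auto

lemma pure_on_const: "pure_on n k A (\<lambda>x. c)"
  unfolding pure_on_def by (intro bexI[of _ "\<lambda>x. c"] pure_A_trace_polys.const) simp

lemma pure_on_add:
  assumes "pure_on n k A f" "pure_on n k A g"
  shows "pure_on n k A (\<lambda>x. f x + g x)"
proof -
  from assms obtain p q where "p \<in> pure_A_trace_polys n k A" "q \<in> pure_A_trace_polys n k A"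
    "\<forall>x. (\<forall>i<k. x i \<in> carrier_mat n n) \<longrightarrow> f x = p x" "\<forall>x. (\<forall>i<k. x i \<in> carrier_mat n n) \<longrightarrow> g x = q x"
    unfolding pure_on_def by blast
  then show ?thesis
    unfolding pure_on_def by (intro bexI[OF _ pure_A_trace_polys.add[of p n k A q]]) auto
qed

lemma pure_on_mult:
  assumes "pure_on n k A f" "pure_on n k A g"
  shows "pure_on n k A (\<lambda>x. f x * g x)"
proof -
  from assms obtain p q where "p \<in> pure_A_trace_polys n k A" "q \<in> pure_A_trace_polys n k A"
    "\<forall>x. (\<forall>i<k. x i \<in> carrier_mat n n) \<longrightarrow> f x = p x" "\<forall>x. (\<forall>i<k. x i \<in> carrier_mat n n) \<longrightarrow> g x = q x"
    unfolding pure_on_def by blast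
  then show ?thesis
    unfolding pure_on_def by (intro bexI[OF _ pure_A_trace_polys.mult[of p n k A q]]) auto
qed

lemma pure_on_sum: "(\<And>i. i \<in> I \<Longrightarrow> pure_on n k A (f i)) \<Longrightarrow> pure_on n k A (\<lambda>x. \<Sum>i\<in>I. f i x)"
  by (induction I rule: infinite_finite_induct) (auto intro: pure_on_const pure_on_add)

lemma A_word_carrier:
  assumes "\<forall>(a, i)\<in>set ps. a \<in> carrier_mat n n \<and> x i \<in> carrier_mat n n"
  shows "A_word n ps x \<in> carrier_mat n n"
  using assms by (induction ps) (auto simp: A_word_def)

lemma A_word_append:
  assumes "\<forall>(a, i)\<in>set ps \<union> set qs. a \<in> carrier_mat n n \<and> x i \<in> carrier_mat n n"
  shows "A_word n (ps @ qs) x = A_word n ps x * A_word n qs x"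
  using assms
proof (induction ps)
  case Nil
  then show ?case
    using A_word_carrier[of qs n x] by (simp add: A_word_def[of n "[]"])
next
  case (Cons p ps)
  obtain a i where p: "p = (a, i)" by (cases p)
  have carrier: "a \<in> carrier_mat n n" "x i \<in> carrier_mat n n"
      "A_word n ps x \<in> carrier_mat n n" "A_word n qs x \<in> carrier_mat n n"
    using Cons.prems p by (auto intro!: A_word_carrier)
  have "A_word n ((p # ps) @ qs) x = a * x i * A_word n (ps @ qs) x"
    by (simp add: A_word_def p)
  also have "\<dots> = a * x i * (A_word n ps x * A_word n qs x)"
    using Cons by simp
  also have "\<dots> = (a * x i * A_word n ps x) * A_word n qs x"
    using carrier by (intro assoc_mult_mat[symmetric]) (auto intro: mult_carrier_mat)
  finally show ?case by (simp add: A_word_def p)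
qed

lemma sum_PiE_insert:
  assumes "m \<notin> J"
  shows "(\<Sum>r\<in>PiE (insert m J) (\<lambda>_. B). f r) = (\<Sum>r\<in>PiE J (\<lambda>_. B). \<Sum>q\<in>B. f (r(m := q)))"
proof -
  have "(\<Sum>r\<in>PiE (insert m J) (\<lambda>_. B). f r) = (\<Sum>(q, r)\<in>B \<times> PiE J (\<lambda>_. B). f (r(m := q)))"
    unfolding PiE_insert_eq
    by (subst sum.reindex[OF inj_combinator[OF assms]]) (simp add: case_prod_unfold)
  also have "\<dots> = (\<Sum>q\<in>B. \<Sum>r\<in>PiE J (\<lambda>_. B). f (r(m := q)))"
    by (rule sum.cartesian_product[symmetric])
  also have "\<dots> = (\<Sum>r\<in>PiE J (\<lambda>_. B). \<Sum>q\<in>B. f (r(m := q)))"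
    by (rule sum.swap)
  finally show ?thesis .
qed

text \<open>Such a sum is a product of traces along the cycles of \<open>\<sigma>\<close>. Removing a point from its
  cycle multiplies its matrix onto the one of its predecessor, or splits off a trace if it is fixed.\<close>
lemma pure_on_cycle_sum:
  fixes A :: "'a::field mat set"
  assumes "finite J" "\<sigma> permutes J" and A: "A \<subseteq> carrier_mat n n"
    and "\<And>j. j \<in> J \<Longrightarrow> \<forall>(a, i)\<in>set (w j). a \<in> A \<and> i < k"
  shows "pure_on n k A (\<lambda>x. \<Sum>r\<in>PiE J (\<lambda>_. {..<n}). \<Prod>j\<in>J. A_word n (w j) x $$ (r j, r (\<sigma> j)))"
  using assms(1,2,4)
proof (induction J arbitrary: \<sigma> w rule: finite_induct)
  case empty
  then show ?case by (simp add: pure_on_const)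
next
  case (insert m J)
  \<comment> \<open>\<sigma> with \<open>m\<close> cut out of its cycle: the predecessor of
    \<open>m\<close> now goes to \<open>\<sigma> m\<close>, and \<open>m\<close> becomes
    fixed.\<close>
  define \<sigma>' where "\<sigma>' = Transposition.transpose m (\<sigma> m) \<circ> \<sigma>"
  have \<sigma>': "\<sigma>' permutes J"
    unfolding \<sigma>'_def by (rule permutes_insert_lemma) fact
  have J_mem: "\<sigma> j \<in> insert m J" if "j \<in> insert m J" for j
    using permutes_in_image[OF insert.prems(1)] that by simp
  have inj: "\<sigma> i = \<sigma> j \<longleftrightarrow> i = j" for i j
    using permutes_inj[OF insert.prems(1)] by (auto dest: injD)
  have carrier: "\<forall>(a, i)\<in>set (w j). a \<in> carrier_mat n n \<and> x i \<in> carrier_mat n n"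
    if "j \<in> insert m J" "\<And>i. i < k \<Longrightarrow> x i \<in> carrier_mat n n" for x :: "nat \<Rightarrow> 'a mat" and j
    using insert.prems(2)[OF that(1)] that(2) A by fastforce
  have step: "(\<Sum>r\<in>PiE (insert m J) (\<lambda>_. {..<n}). \<Prod>j\<in>insert m J. A_word n (w j) x $$ (r j, r (\<sigma> j))) =
      (\<Sum>r\<in>PiE J (\<lambda>_. {..<n}). \<Sum>q<n. A_word n (w m) x $$ (q, (r(m := q)) (\<sigma> m)) *
        (\<Prod>j\<in>J. A_word n (w j) x $$ (r j, (r(m := q)) (\<sigma> j))))" for x
  proof -
    have "(\<Prod>j\<in>insert m J. A_word n (w j) x $$ ((r(m := q)) j, (r(m := q)) (\<sigma> j))) =
        A_word n (w m) x $$ (q, (r(m := q)) (\<sigma> m)) *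
        (\<Prod>j\<in>J. A_word n (w j) x $$ (r j, (r(m := q)) (\<sigma> j)))" for r q
    proof -
      have "(\<Prod>j\<in>J. A_word n (w j) x $$ ((r(m := q)) j, (r(m := q)) (\<sigma> j))) =
          (\<Prod>j\<in>J. A_word n (w j) x $$ (r j, (r(m := q)) (\<sigma> j)))"
        using insert.hyps(2) by (intro prod.cong refl) auto
      then show ?thesis using insert.hyps by simp
    qed
    then show ?thesis by (simp only: sum_PiE_insert[OF insert.hyps(2)])
  qed
  show ?case
  proof (cases "\<sigma> m = m")
    case True
    then have "\<sigma>' = \<sigma>" by (simp add: \<sigma>'_def)
    then have \<sigma>_J: "\<sigma> permutes J" using \<sigma>' by simp
    have "pure_on n k A (\<lambda>x. mat_tr (A_word n (w m) x))"
      unfolding pure_on_def using insert.prems(2)[of m] by (intro bexI[OF _ pure_A_trace_polys.gen]) auto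
    moreover have "pure_on n k A (\<lambda>x. \<Sum>r\<in>PiE J (\<lambda>_. {..<n}). \<Prod>j\<in>J. A_word n (w j) x $$ (r j, r (\<sigma> j)))"
      using insert.prems(2) by (intro insert.IH \<sigma>_J) auto
    ultimately have "pure_on n k A (\<lambda>x. mat_tr (A_word n (w m) x) *
        (\<Sum>r\<in>PiE J (\<lambda>_. {..<n}). \<Prod>j\<in>J. A_word n (w j) x $$ (r j, r (\<sigma> j))))"
      by (rule pure_on_mult)
    then show ?thesis
    proof (rule pure_on_cong)
      fix x :: "nat \<Rightarrow> 'a mat" assume x: "\<And>i. i < k \<Longrightarrow> x i \<in> carrier_mat n n"
      have "A_word n (w m) x \<in> carrier_mat n n"
        using carrier[of m x] x by (intro A_word_carrier) auto
      then have tr: "mat_tr (A_word n (w m) x) = (\<Sum>q<n. A_word n (w m) x $$ (q, q))"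
        by (auto simp: mat_tr_def)
      have "(\<Prod>j\<in>J. A_word n (w j) x $$ (r j, (r(m := q)) (\<sigma> j))) =
          (\<Prod>j\<in>J. A_word n (w j) x $$ (r j, r (\<sigma> j)))" for r q
        using insert.hyps(2) True inj[of _ m] by (intro prod.cong refl) auto
      then show "(\<Sum>r\<in>PiE (insert m J) (\<lambda>_. {..<n}). \<Prod>j\<in>insert m J. A_word n (w j) x $$ (r j, r (\<sigma> j))) =
          mat_tr (A_word n (w m) x) *
          (\<Sum>r\<in>PiE J (\<lambda>_. {..<n}). \<Prod>j\<in>J. A_word n (w j) x $$ (r j, r (\<sigma> j)))"
        by (simp add: step tr True sum_distrib_left sum_distrib_right)
    qed
  next
    case False
    then have \<sigma>m: "\<sigma> m \<in> J" using J_mem by auto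
    obtain l where l: "\<sigma> l = m" using permutes_surj[OF insert.prems(1)] by (metis surjD)
    then have lm: "l \<noteq> m" using False by auto
    have "l \<in> J"
      using l lm permutes_not_in[OF insert.prems(1), of l] by auto
    \<comment> \<open>The sum over the index at \<open>m\<close> is the inner sum of a matrix
      product, which on words is concatenation.\<close>
    define w' where "w' = w(l := w l @ w m)"
    have "pure_on n k A (\<lambda>x. \<Sum>r\<in>PiE J (\<lambda>_. {..<n}). \<Prod>j\<in>J. A_word n (w' j) x $$ (r j, r (\<sigma>' j)))"
    proof (intro insert.IH \<sigma>')
      fix j assume "j \<in> J"
      then show "\<forall>(a, i)\<in>set (w' j). a \<in> A \<and> i < k"
        using insert.prems(2)[of j] insert.prems(2)[of m] by (auto simp: w'_def)
    qed
    then show ?thesis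
    proof (rule pure_on_cong)
      fix x :: "nat \<Rightarrow> 'a mat" assume x: "\<And>i. i < k \<Longrightarrow> x i \<in> carrier_mat n n"
      let ?W = "\<lambda>j. A_word n (w j) x"
      have W: "?W j \<in> carrier_mat n n" if "j \<in> insert m J" for j
        using carrier[of j x] that x by (intro A_word_carrier) auto
      have W': "A_word n (w' l) x = ?W l * ?W m"
        using carrier[of l x] carrier[of m x] x \<open>l \<in> J\<close>
        unfolding w'_def fun_upd_same by (intro A_word_append) auto
      show "(\<Sum>r\<in>PiE (insert m J) (\<lambda>_. {..<n}). \<Prod>j\<in>insert m J. ?W j $$ (r j, r (\<sigma> j))) =
          (\<Sum>r\<in>PiE J (\<lambda>_. {..<n}). \<Prod>j\<in>J. A_word n (w' j) x $$ (r j, r (\<sigma>' j)))"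
        unfolding step
      proof (rule sum.cong[OF refl])
        fix r assume r: "r \<in> PiE J (\<lambda>_. {..<n})"
        have rn: "r l < n" "r (\<sigma> m) < n"
          using r \<open>l \<in> J\<close> \<sigma>m by auto
        have rest: "(\<Prod>j\<in>J - {l}. ?W j $$ (r j, (r(m := q)) (\<sigma> j))) =
            (\<Prod>j\<in>J - {l}. A_word n (w' j) x $$ (r j, r (\<sigma>' j)))" for q
        proof (rule prod.cong[OF refl])
          fix j assume j: "j \<in> J - {l}"
          then have "\<sigma> j \<noteq> m" "\<sigma> j \<noteq> \<sigma> m"
            using l inj[of j l] inj[of j m] insert.hyps(2) by auto
          then show "?W j $$ (r j, (r(m := q)) (\<sigma> j)) = A_word n (w' j) x $$ (r j, r (\<sigma>' j))"
            using j by (simp add: \<sigma>'_def w'_def)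
        qed
        have prod: "(\<Prod>j\<in>J. ?W j $$ (r j, (r(m := q)) (\<sigma> j))) =
            ?W l $$ (r l, q) * (\<Prod>j\<in>J - {l}. A_word n (w' j) x $$ (r j, r (\<sigma>' j)))" for q
          by (subst prod.remove[OF insert.hyps(1) \<open>l \<in> J\<close>]) (simp only: rest l fun_upd_same)
        have "(\<Sum>q<n. ?W m $$ (q, (r(m := q)) (\<sigma> m)) * (\<Prod>j\<in>J. ?W j $$ (r j, (r(m := q)) (\<sigma> j)))) =
            (\<Sum>q<n. ?W l $$ (r l, q) * ?W m $$ (q, r (\<sigma> m)) *
              (\<Prod>j\<in>J - {l}. A_word n (w' j) x $$ (r j, r (\<sigma>' j))))"
          by (intro sum.cong refl) (simp only: prod fun_upd_other[OF False] mult_ac)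
        also have "\<dots> = (\<Sum>q<n. ?W l $$ (r l, q) * ?W m $$ (q, r (\<sigma> m))) *
              (\<Prod>j\<in>J - {l}. A_word n (w' j) x $$ (r j, r (\<sigma>' j)))"
          by (simp add: sum_distrib_right)
        also have "(\<Sum>q<n. ?W l $$ (r l, q) * ?W m $$ (q, r (\<sigma> m))) = A_word n (w' l) x $$ (r l, r (\<sigma>' l))"
          using W[of l] W[of m] rn \<open>l \<in> J\<close> l
          by (auto simp: W' \<sigma>'_def scalar_prod_def atLeast0LessThan)
        also have "A_word n (w' l) x $$ (r l, r (\<sigma>' l)) * (\<Prod>j\<in>J - {l}. A_word n (w' j) x $$ (r j, r (\<sigma>' j))) =
            (\<Prod>j\<in>J. A_word n (w' j) x $$ (r j, r (\<sigma>' j)))"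
          using insert.hyps(1) \<open>l \<in> J\<close> by (rule prod.remove[symmetric])
        finally show "(\<Sum>q<n. ?W m $$ (q, (r(m := q)) (\<sigma> m)) * (\<Prod>j\<in>J. ?W j $$ (r j, (r(m := q)) (\<sigma> j)))) =
            (\<Prod>j\<in>J. A_word n (w' j) x $$ (r j, r (\<sigma>' j)))" .
      qed
    qed
  qed
qed

text \<open>The double sum is the trace of the tensor composed with
  \<open>x (i 0) \<otimes> \<dots> \<otimes> x (i (d - 1))\<close>. Factor \<open>j\<close> has
  column index \<open>s (\<sigma> j)\<close>, so summing out \<open>s\<close> multiplies
  \<open>a j\<close> by \<open>x (i (\<sigma> j))\<close> and leaves a cycle sum of one-letter
  words.\<close>

lemma pure_on_tensor_perm:
  fixes A :: "'a::field mat set"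
  assumes \<sigma>: "\<sigma> permutes {..<d}" and A: "A \<subseteq> carrier_mat n n"
    and a: "\<And>j. j < d \<Longrightarrow> a j \<in> mat_fun n ` A" and i: "\<And>j. j < d \<Longrightarrow> i j < k"
  shows "pure_on n k A (\<lambda>x. \<Sum>r\<in>multi_indices n d. \<Sum>s\<in>multi_indices n d.
    tensor_perm n d \<sigma> a r s * (\<Prod>j<d. x (i j) $$ (s j, r j)))"
proof -
  let ?R = "multi_indices n d"
  have "\<forall>j. \<exists>M. j < d \<longrightarrow> M \<in> A \<and> a j = mat_fun n M" using a by blast
  then obtain M where M: "\<And>j. j < d \<Longrightarrow> M j \<in> A" "\<And>j. j < d \<Longrightarrow> a j = mat_fun n (M j)"
    by metis
  define w where "w j = [(M j, i (\<sigma> j))]" for j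
  have "pure_on n k A (\<lambda>x. \<Sum>r\<in>?R. \<Prod>j<d. A_word n (w j) x $$ (r j, r (\<sigma> j)))"
    unfolding multi_indices_def using \<sigma> A M i perm_less[OF \<sigma>]
    by (intro pure_on_cycle_sum) (auto simp: w_def)
  then show ?thesis
  proof (rule pure_on_cong)
    fix x :: "nat \<Rightarrow> 'a mat" assume x: "\<And>i. i < k \<Longrightarrow> x i \<in> carrier_mat n n"
    have "(\<Sum>s\<in>?R. tensor_perm n d \<sigma> a r s * (\<Prod>j<d. x (i j) $$ (s j, r j))) =
        (\<Prod>j<d. A_word n (w j) x $$ (r j, r (\<sigma> j)))" if r: "r \<in> ?R" for r
    proof -
      let ?f = "\<lambda>j k. a j (r j) k * x (i (\<sigma> j)) $$ (k, r (\<sigma> j))"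
      have "(\<Prod>j<d. x (i j) $$ (s j, r j)) = (\<Prod>j<d. x (i (\<sigma> j)) $$ (s (\<sigma> j), r (\<sigma> j)))" for s
        by (rule prod_permute[OF \<sigma>, of "\<lambda>j. x (i j) $$ (s j, r j)", symmetric])
      then have "(\<Sum>s\<in>?R. tensor_perm n d \<sigma> a r s * (\<Prod>j<d. x (i j) $$ (s j, r j))) =
          (\<Sum>s\<in>?R. \<Prod>j<d. ?f j ((s \<circ> \<sigma>) j))"
        using r by (intro sum.cong refl) (simp add: tensor_perm_def prod.distrib)
      \<comment> \<open>Composition with \<sigma> permutes the multi-indices; afterwards each factor
        has a summation index of its own.\<close>
      also have "\<dots> = (\<Sum>s\<in>?R. \<Prod>j<d. ?f j (s j))"
      proof (rule sum.reindex_bij_betw[of "\<lambda>s. s \<circ> \<sigma>" ?R ?R "\<lambda>s. \<Prod>j<d. ?f j (s j)"])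
        show "bij_betw (\<lambda>s. s \<circ> \<sigma>) ?R ?R"
          using multi_indices_comp[OF \<sigma>] multi_indices_comp[OF permutes_inv[OF \<sigma>]]
          by (intro bij_betw_byWitness[where f' = "\<lambda>s. s \<circ> inv_into UNIV \<sigma>"])
            (auto simp: fun_eq_iff permutes_inverses[OF \<sigma>])
      qed
      also have "\<dots> = (\<Prod>j<d. \<Sum>k<n. ?f j k)" by (rule sum_multi_indices_prod)
      also have "\<dots> = (\<Prod>j<d. A_word n (w j) x $$ (r j, r (\<sigma> j)))"
      proof (rule prod.cong[OF refl])
        fix j assume "j \<in> {..<d}"
        then have j: "j < d" by simp
        have "M j \<in> carrier_mat n n" "x (i (\<sigma> j)) \<in> carrier_mat n n"
          using M(1)[OF j] A x i perm_less[OF \<sigma> j] by auto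
        moreover have "r j < n" "r (\<sigma> j) < n"
          using r j perm_less[OF \<sigma> j] by (auto simp: multi_indices_less)
        ultimately show "(\<Sum>k<n. ?f j k) = A_word n (w j) x $$ (r j, r (\<sigma> j))"
          by (auto simp: M(2)[OF j] A_word_def w_def mat_fun_def scalar_prod_def atLeast0LessThan
              simp del: assoc_mult_mat)
      qed
      finally show ?thesis .
    qed
    then show "(\<Sum>r\<in>?R. \<Sum>s\<in>?R. tensor_perm n d \<sigma> a r s * (\<Prod>j<d. x (i j) $$ (s j, r j))) =
        (\<Sum>r\<in>?R. \<Prod>j<d. A_word n (w j) x $$ (r j, r (\<sigma> j)))"
      by (intro sum.cong refl)
  qed
qed

lemma pure_on_span_tensor_perm:
  assumes K: "K \<in> kernel.span {tensor_perm n d \<sigma> a |\<sigma> a. \<sigma> permutes {..<d} \<and> (\<forall>j<d. a j \<in> mat_fun n ` A)}"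
    and A: "A \<subseteq> carrier_mat n n" and i: "\<And>j. j < d \<Longrightarrow> i j < k"
  shows "pure_on n k A (\<lambda>x. \<Sum>r\<in>multi_indices n d. \<Sum>s\<in>multi_indices n d.
    K r s * (\<Prod>j<d. x (i j) $$ (s j, r j)))"
proof -
  let ?P = "\<lambda>K. pure_on n k A (\<lambda>x. \<Sum>r\<in>multi_indices n d. \<Sum>s\<in>multi_indices n d.
    K r s * (\<Prod>j<d. x (i j) $$ (s j, r j)))"
  have "kernel.subspace {K. ?P K}"
    unfolding kernel.subspace_def mem_Collect_eq
  proof (intro conjI ballI allI)
    show "?P 0" by (simp add: pure_on_const)
    show "?P (K + L)" if "K \<in> {K. ?P K}" "L \<in> {K. ?P K}" for K L
      using pure_on_add[of n k A, OF that[unfolded mem_Collect_eq]]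
      by (simp add: distrib_right sum.distrib)
    show "?P (scale2 c K)" if "K \<in> {K. ?P K}" for c K
      using pure_on_mult[of n k A, OF pure_on_const[of n k A c] that[unfolded mem_Collect_eq]]
      by (simp add: mult.assoc sum_distrib_left)
  qed
  then have "kernel.span {tensor_perm n d \<sigma> a |\<sigma> a. \<sigma> permutes {..<d} \<and> (\<forall>j<d. a j \<in> mat_fun n ` A)} \<subseteq> {K. ?P K}"
    using pure_on_tensor_perm[OF _ A _ i] by (intro kernel.span_minimal) auto
  then show ?thesis using K by blast
qed

section \<open>Polarization and density of units\<close>

text \<open>Adding or removing a fixed element of \<open>X\<close> outside \<open>T\<close> flips
  the sign, so the terms cancel in pairs: Moebius inversion on subsets.\<close>

lemma sum_alternating_interval:
  assumes "finite X" "T \<subseteq> X"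
  shows "(\<Sum>S\<in>Pow X. if T \<subseteq> S then (-1) ^ (card X - card S) else 0) = (if T = X then 1 else (0::'a::comm_ring_1))"
proof (cases "T = X")
  case True
  have "(\<Sum>S\<in>Pow X. if T \<subseteq> S then (-1) ^ (card X - card S) else 0) =
      (\<Sum>S\<in>Pow X. if S = X then (1::'a) else 0)"
    using True by (intro sum.cong) auto
  then show ?thesis using True assms by simp
next
  case False
  then obtain x where x: "x \<in> X" "x \<notin> T" using assms by blast
  define Y where "Y = X - {x}"
  have X: "X = insert x Y" "x \<notin> Y" "finite Y" using x assms by (auto simp: Y_def)
  let ?f = "\<lambda>S. if T \<subseteq> S then (-1) ^ (card X - card S) else (0::'a)"
  have inj: "inj_on (insert x) (Pow Y)" using X by (auto simp: inj_on_def)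
  have "(\<Sum>S\<in>Pow X. ?f S) = (\<Sum>S\<in>Pow Y. ?f S) + (\<Sum>S\<in>insert x ` Pow Y. ?f S)"
    unfolding X(1) Pow_insert using X by (intro sum.union_disjoint) auto
  also have "(\<Sum>S\<in>insert x ` Pow Y. ?f S) = (\<Sum>S\<in>Pow Y. ?f (insert x S))"
    by (simp add: sum.reindex[OF inj])
  also have "\<dots> = (\<Sum>S\<in>Pow Y. - ?f S)"
  proof (rule sum.cong[OF refl])
    fix S assume "S \<in> Pow Y"
    then have S: "finite S" "x \<notin> S" "card S \<le> card Y"
      using X by (auto intro: finite_subset card_mono)
    then have "card X - card S = Suc (card X - card (insert x S))"
      using X by simp
    moreover have "T \<subseteq> insert x S \<longleftrightarrow> T \<subseteq> S" using x by auto
    ultimately show "?f (insert x S) = - ?f S" by simp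
  qed
  finally show ?thesis using False by (simp add: sum_negf)
qed

text \<open>A map from \<open>d\<close> points that hits all of \<open>{..<d}\<close> has no room
  for the extra value \<open>d\<close>, hence is a bijection.\<close>

lemma sum_surjections_eq_permutations:
  fixes y :: "nat \<Rightarrow> nat \<Rightarrow> 'a::comm_ring_1"
  shows "(\<Sum>\<phi> | \<phi> \<in> PiE {..<d} (\<lambda>_. {..d}) \<and> \<phi> ` {..<d} - {d} = {..<d}. \<Prod>j<d. y (\<phi> j) j) =
    (\<Sum>\<sigma> | \<sigma> permutes {..<d}. \<Prod>j<d. y (\<sigma> j) j)"
proof (rule sum.reindex_bij_witness[where i = "\<lambda>\<sigma>. restrict \<sigma> {..<d}" and j = "\<lambda>\<phi> j. if j < d then \<phi> j else j"])
  fix \<phi> assume "\<phi> \<in> {\<phi> \<in> PiE {..<d} (\<lambda>_. {..d}). \<phi> ` {..<d} - {d} = {..<d}}"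
  then have \<phi>: "\<phi> \<in> PiE {..<d} (\<lambda>_. {..d})" "{..<d} \<subseteq> \<phi> ` {..<d}" by auto
  have im: "\<phi> ` {..<d} = {..<d}"
    using \<phi>(2) card_image_le[of "{..<d}" \<phi>] by (intro card_seteq[symmetric]) auto
  then have bij: "bij_betw \<phi> {..<d} {..<d}"
    by (simp add: bij_betw_def eq_card_imp_inj_on)
  show "restrict (\<lambda>j. if j < d then \<phi> j else j) {..<d} = \<phi>"
    using PiE_arb[OF \<phi>(1)] by (intro ext) (simp add: restrict_def)
  show "(\<lambda>j. if j < d then \<phi> j else j) \<in> {\<sigma>. \<sigma> permutes {..<d}}"
    unfolding mem_Collect_eq
  proof (rule bij_imp_permutes)
    show "bij_betw (\<lambda>j. if j < d then \<phi> j else j) {..<d} {..<d}"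
      using bij by (subst bij_betw_cong[where g = \<phi>]) auto
  qed simp
  show "(\<Prod>j<d. y (if j < d then \<phi> j else j) j) = (\<Prod>j<d. y (\<phi> j) j)"
    by (intro prod.cong) auto
next
  fix \<sigma> assume "\<sigma> \<in> {\<sigma>. \<sigma> permutes {..<d}}"
  then have \<sigma>: "\<sigma> permutes {..<d}" by simp
  show "(\<lambda>j. if j < d then restrict \<sigma> {..<d} j else j) = \<sigma>"
    using permutes_not_in[OF \<sigma>] by (auto simp: fun_eq_iff)
  have "\<sigma> ` {..<d} = {..<d}" by (rule permutes_image[OF \<sigma>])
  then show "restrict \<sigma> {..<d} \<in> {\<phi> \<in> PiE {..<d} (\<lambda>_. {..d}). \<phi> ` {..<d} - {d} = {..<d}}"
    using perm_less[OF \<sigma>] by (auto simp: less_imp_le)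
qed

text \<open>Expanding the product over maps \<open>\<phi>\<close> (the value \<open>d\<close> marking a factor \<open>z\<close>),
  inclusion-exclusion keeps only the \<open>\<phi>\<close> that hit all of \<open>{..<d}\<close>.\<close>
lemma polarization:
  fixes y :: "nat \<Rightarrow> nat \<Rightarrow> 'a::comm_ring_1"
  assumes "m \<le> d"
  shows "(\<Sum>S\<in>Pow {..<d}. (-1) ^ (d - card S) * (\<Prod>j<m. z j + (\<Sum>l\<in>S. y l j))) =
    (if m = d then \<Sum>\<sigma> | \<sigma> permutes {..<d}. \<Prod>j<d. y (\<sigma> j) j else 0)"
proof -
  define Y where "Y l j = (if l = d then z j else y l j)" for l j
  define \<Phi> where "\<Phi> = PiE {..<m} (\<lambda>_. {..d})"
  have fin: "finite \<Phi>" unfolding \<Phi>_def by (rule finite_PiE) auto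
  have prod_eq: "(\<Prod>j<m. z j + (\<Sum>l\<in>S. y l j)) =
      (\<Sum>\<phi>\<in>\<Phi>. if \<phi> ` {..<m} - {d} \<subseteq> S then \<Prod>j<m. Y (\<phi> j) j else 0)" if "S \<in> Pow {..<d}" for S
  proof -
    have S: "finite S" "d \<notin> S" "S \<subseteq> {..<d}" using that by (auto intro: finite_subset)
    have "z j + (\<Sum>l\<in>S. y l j) = (\<Sum>l\<in>insert d S. Y l j)" for j
    proof -
      have "(\<Sum>l\<in>S. y l j) = (\<Sum>l\<in>S. Y l j)"
        using S by (intro sum.cong) (auto simp: Y_def)
      then show ?thesis using S by (simp add: Y_def)
    qed
    then have "(\<Prod>j<m. z j + (\<Sum>l\<in>S. y l j)) = (\<Prod>j<m. \<Sum>l\<in>insert d S. Y l j)"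
      by (simp only:)
    also have "\<dots> = (\<Sum>\<phi>\<in>PiE {..<m} (\<lambda>_. insert d S). \<Prod>j<m. Y (\<phi> j) j)"
      using S by (intro prod_sum_PiE) auto
    also have "PiE {..<m} (\<lambda>_. insert d S) = {\<phi> \<in> \<Phi>. \<phi> ` {..<m} - {d} \<subseteq> S}"
    proof -
      have *: "l \<in> insert d S \<longleftrightarrow> l \<in> {..d} \<and> (l \<noteq> d \<longrightarrow> l \<in> S)" for l
        using S(3) by auto
      have **: "\<phi> ` {..<m} - {d} \<subseteq> S \<longleftrightarrow> (\<forall>j\<in>{..<m}. \<phi> j \<noteq> d \<longrightarrow> \<phi> j \<in> S)" for \<phi>
        by blast
      show ?thesis
        by (rule Set.set_eqI) (simp only: \<Phi>_def PiE_iff mem_Collect_eq * ** ball_conj_distrib conj_ac)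
    qed
    also have "(\<Sum>\<phi> | \<phi> \<in> \<Phi> \<and> \<phi> ` {..<m} - {d} \<subseteq> S. \<Prod>j<m. Y (\<phi> j) j) =
        (\<Sum>\<phi>\<in>\<Phi>. if \<phi> ` {..<m} - {d} \<subseteq> S then \<Prod>j<m. Y (\<phi> j) j else 0)"
      using fin by (simp add: sum.inter_filter)
    finally show ?thesis .
  qed
  have "(\<Sum>S\<in>Pow {..<d}. (-1) ^ (d - card S) * (\<Prod>j<m. z j + (\<Sum>l\<in>S. y l j))) =
      (\<Sum>S\<in>Pow {..<d}. \<Sum>\<phi>\<in>\<Phi>. (\<Prod>j<m. Y (\<phi> j) j) *
        (if \<phi> ` {..<m} - {d} \<subseteq> S then (-1) ^ (card {..<d} - card S) else 0))"
    by (intro sum.cong refl) (auto simp: prod_eq sum_distrib_left intro!: sum.cong)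
  also have "\<dots> = (\<Sum>\<phi>\<in>\<Phi>. (\<Prod>j<m. Y (\<phi> j) j) *
      (\<Sum>S\<in>Pow {..<d}. if \<phi> ` {..<m} - {d} \<subseteq> S then (-1) ^ (card {..<d} - card S) else 0))"
    by (subst sum.swap) (simp add: sum_distrib_left)
  also have "\<dots> = (\<Sum>\<phi>\<in>\<Phi>. if \<phi> ` {..<m} - {d} = {..<d} then \<Prod>j<m. Y (\<phi> j) j else 0)"
  proof (rule sum.cong[OF refl])
    fix \<phi> assume "\<phi> \<in> \<Phi>"
    then have "\<phi> ` {..<m} \<subseteq> {..d}" unfolding \<Phi>_def by (blast dest: PiE_mem)
    moreover have "{..d} - {d} = {..<d}" by auto
    ultimately have "\<phi> ` {..<m} - {d} \<subseteq> {..<d}" by blast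
    then show "(\<Prod>j<m. Y (\<phi> j) j) *
        (\<Sum>S\<in>Pow {..<d}. if \<phi> ` {..<m} - {d} \<subseteq> S then (-1) ^ (card {..<d} - card S) else 0) =
        (if \<phi> ` {..<m} - {d} = {..<d} then \<Prod>j<m. Y (\<phi> j) j else 0)"
      by (subst sum_alternating_interval) auto
  qed
  also have "\<dots> = (\<Sum>\<phi> | \<phi> \<in> \<Phi> \<and> \<phi> ` {..<m} - {d} = {..<d}. \<Prod>j<m. Y (\<phi> j) j)"
    using fin by (simp add: sum.inter_filter)
  also have "\<dots> = (if m = d then \<Sum>\<sigma> | \<sigma> permutes {..<d}. \<Prod>j<d. y (\<sigma> j) j else 0)"
  proof (cases "m = d")
    case True
    have "(\<Prod>j<d. Y (\<sigma> j) j) = (\<Prod>j<d. y (\<sigma> j) j)" if "\<sigma> permutes {..<d}" for \<sigma>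
      using perm_less[OF that] by (intro prod.cong refl) (auto simp: Y_def)
    then show ?thesis
      using True sum_surjections_eq_permutations[where d = d and y = Y] by (simp add: \<Phi>_def)
  next
    case False
    \<comment> \<open>Fewer than \<open>d\<close> factors cannot cover \<open>{..<d}\<close>; this
      is what removes the terms of lower degree.\<close>
    have "\<phi> ` {..<m} - {d} \<noteq> {..<d}" for \<phi>
    proof
      assume "\<phi> ` {..<m} - {d} = {..<d}"
      then have "card {..<d} \<le> card (\<phi> ` {..<m})"
        by (intro card_mono) auto
      also have "\<dots> \<le> m" using card_image_le[of "{..<m}" \<phi>] by simp
      finally show False using False assms by simp
    qed
    then show ?thesis using False by simp
  qed
  finally show ?thesis .
qed

section \<open>Units among the scalar shifts of the centralizer\<close>

lemma finite_det_add_scalar_zero: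
  fixes M :: "'a::field mat"
  assumes M: "M \<in> carrier_mat n n"
  shows "finite {t. det (M + t \<cdot>\<^sub>m 1\<^sub>m n) = 0}"
proof -
  \<comment> \<open>A singular shift makes \<open>- t\<close> an eigenvalue.\<close>
  have "{t. det (M + t \<cdot>\<^sub>m 1\<^sub>m n) = 0} \<subseteq> uminus ` spectrum M"
  proof
    fix t assume "t \<in> {t. det (M + t \<cdot>\<^sub>m 1\<^sub>m n) = 0}"
    then have "eigenvalue M (- t)"
      using M by (simp add: eigenvalue_det[OF M] char_matrix_def)
    then show "t \<in> uminus ` spectrum M"
      by (intro image_eqI[of _ _ "- t"]) (auto simp: spectrum_def)
  qed
  then show ?thesis
    using card_finite_spectrum(1)[OF M] by (auto intro: finite_subset)
qed

text \<open>Units of the centralizer as functions, each paired with an explicit inverse and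
  constrained only at indices below \<open>n\<close>.\<close>

definition units_commuting :: "nat \<Rightarrow> (nat \<Rightarrow> nat \<Rightarrow> 'a::field) set \<Rightarrow> ((nat \<Rightarrow> nat \<Rightarrow> 'a) \<times> (nat \<Rightarrow> nat \<Rightarrow> 'a)) set" where
  "units_commuting n B = {(g, h).
     (\<forall>r<n. \<forall>s<n. mmul n g h r s = (if r = s then 1 else 0) \<and> mmul n h g r s = (if r = s then 1 else 0)) \<and>
     (\<forall>a\<in>B. \<forall>r<n. \<forall>s<n. mmul n a g r s = mmul n g a r s)}"

lemma mmul_mat:
  "mmul n a b r s = (mat n n (\<lambda>(r, s). a r s) * mat n n (\<lambda>(r, s). b r s)) $$ (r, s)"
  if "r < n" "s < n"
  using that by (simp add: mmul_def scalar_prod_def atLeast0LessThan)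

text \<open>Adding a scalar matrix stays in the centralizer, and only finitely many shifts are
  singular.\<close>

lemma finite_not_unit_shift:
  fixes c :: "nat \<Rightarrow> nat \<Rightarrow> 'a::field"
  assumes c: "\<And>a r s. a \<in> B \<Longrightarrow> r < n \<Longrightarrow> s < n \<Longrightarrow> mmul n a c r s = mmul n c a r s"
  shows "finite {t. \<nexists>h. ((\<lambda>r s. (if r = s then t else 0) + c r s), h) \<in> units_commuting n B}"
proof (rule finite_subset)
  let ?M = "mat n n (\<lambda>(r, s). c r s)"
  show "finite {t. det (?M + t \<cdot>\<^sub>m 1\<^sub>m n) = 0}"
    by (rule finite_det_add_scalar_zero) simp
  show "{t. \<nexists>h. ((\<lambda>r s. (if r = s then t else 0) + c r s), h) \<in> units_commuting n B} \<subseteq>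
      {t. det (?M + t \<cdot>\<^sub>m 1\<^sub>m n) = 0}"
  proof (rule subsetI, rule ccontr)
    fix t
    assume no: "t \<in> {t. \<nexists>h. ((\<lambda>r s. (if r = s then t else 0) + c r s), h) \<in> units_commuting n B}"
      and det: "t \<notin> {t. det (?M + t \<cdot>\<^sub>m 1\<^sub>m n) = 0}"
    let ?g = "\<lambda>r s. (if r = s then t else 0) + c r s"
    have G: "?M + t \<cdot>\<^sub>m 1\<^sub>m n = mat n n (\<lambda>(r, s). ?g r s)"
      by (rule eq_matI) auto
    have "?M + t \<cdot>\<^sub>m 1\<^sub>m n \<in> Units (ring_mat TYPE('a) n ())"
      using det by (intro det_non_zero_imp_unit) auto
    then obtain H where H: "H \<in> carrier_mat n n" "H * mat n n (\<lambda>(r, s). ?g r s) = 1\<^sub>m n"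
        "mat n n (\<lambda>(r, s). ?g r s) * H = 1\<^sub>m n"
      unfolding G by (auto simp: Units_def ring_mat_def)
    have H_mat: "H = mat n n (\<lambda>(r, s). H $$ (r, s))" using H(1) by (intro eq_matI) auto
    have "mmul n a ?g r s = mmul n ?g a r s" if "a \<in> B" "r < n" "s < n" for a r s
    proof -
      have "mmul n a ?g r s = (\<Sum>k<n. if k = s then a r k * t else 0) + mmul n a c r s"
        unfolding mmul_def sum.distrib[symmetric] by (intro sum.cong) (auto simp: algebra_simps)
      moreover have "mmul n ?g a r s = (\<Sum>k<n. if r = k then t * a k s else 0) + mmul n c a r s"
        unfolding mmul_def sum.distrib[symmetric] by (intro sum.cong) (auto simp: algebra_simps)
      ultimately show ?thesis using that c[OF that] by simp
    qed
    moreover have "mmul n ?g (\<lambda>r s. H $$ (r, s)) r s = (if r = s then 1 else 0)"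
      "mmul n (\<lambda>r s. H $$ (r, s)) ?g r s = (if r = s then 1 else 0)" if "r < n" "s < n" for r s
      unfolding mmul_mat[OF that] H_mat[symmetric] H(2,3) using that by simp_all
    ultimately have "(?g, \<lambda>r s. H $$ (r, s)) \<in> units_commuting n B"
      by (auto simp: units_commuting_def)
    then show False using no by blast
  qed
qed

text \<open>All but finitely many shifts of a partial sum of the \<open>c l\<close> by a scalar are units, and
  polarization of the identity for these units does not see the scalar.\<close>
lemma commutes_with_symmetric_tensors:
  fixes T :: "(nat \<Rightarrow> nat) \<Rightarrow> (nat \<Rightarrow> nat) \<Rightarrow> 'a::field_char_0"
  assumes comm: "\<And>g h r s. (g, h) \<in> units_commuting n B \<Longrightarrow> r \<in> R \<Longrightarrow> s \<in> R \<Longrightarrow>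
      (\<Sum>t\<in>R. T r t * (\<Prod>j<d. g (t j) (s j))) = (\<Sum>t\<in>R. (\<Prod>j<d. g (r j) (t j)) * T t s)"
    and c: "\<And>j a r s. j < d \<Longrightarrow> a \<in> B \<Longrightarrow> r < n \<Longrightarrow> s < n \<Longrightarrow> mmul n a (c j) r s = mmul n (c j) a r s"
    and rs: "r \<in> R" "s \<in> R"
  shows "(\<Sum>t\<in>R. T r t * (\<Sum>\<sigma> | \<sigma> permutes {..<d}. \<Prod>j<d. c (\<sigma> j) (t j) (s j))) =
      (\<Sum>t\<in>R. (\<Sum>\<sigma> | \<sigma> permutes {..<d}. \<Prod>j<d. c (\<sigma> j) (r j) (t j)) * T t s)"
proof -
  define C where "C S r s = (\<Sum>l\<in>S. c l r s)" for S r s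
  have "finite {t. \<nexists>h. ((\<lambda>r s. (if r = s then t else 0) + C S r s), h) \<in> units_commuting n B}"
    if "S \<in> Pow {..<d}" for S
  proof (rule finite_not_unit_shift)
    fix a r s assume a: "a \<in> B" "r < n" "s < n"
    have "mmul n a (C S) r s = (\<Sum>l\<in>S. mmul n a (c l) r s)"
      unfolding mmul_def C_def sum_distrib_left by (rule sum.swap)
    also have "\<dots> = (\<Sum>l\<in>S. mmul n (c l) a r s)"
      using that a c by (intro sum.cong) auto
    also have "\<dots> = mmul n (C S) a r s"
      unfolding mmul_def C_def sum_distrib_right by (rule sum.swap)
    finally show "mmul n a (C S) r s = mmul n (C S) a r s" .
  qed
  then have "finite (\<Union>S\<in>Pow {..<d}. {t. \<nexists>h. ((\<lambda>r s. (if r = s then t else 0) + C S r s), h) \<in> units_commuting n B})"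
    by (intro finite_UN_I) auto
  \<comment> \<open>The field is infinite, so one scalar works for all partial sums
    \<open>C S\<close> at once; polarization needs the same \<open>z\<close> for every
    \<open>S\<close>.\<close>
  then obtain z where "z \<notin> (\<Union>S\<in>Pow {..<d}. {t. \<nexists>h. ((\<lambda>r s. (if r = s then t else 0) + C S r s), h) \<in> units_commuting n B})"
    using ex_new_if_finite[OF infinite_UNIV_char_0] by blast
  then have z: "\<exists>h. ((\<lambda>r s. (if r = s then z else 0) + C S r s), h) \<in> units_commuting n B" if "S \<in> Pow {..<d}" for S
    using that by blast
  let ?g = "\<lambda>S r s. (if r = s then z else 0) + C S r s"
  \<comment> \<open>The shift is the summand \<open>z\<close> of \<open>polarization\<close>,
    independent of \<open>S\<close>, and therefore absent from the result.\<close>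
  have pol: "(\<Sum>\<sigma> | \<sigma> permutes {..<d}. \<Prod>j<d. c (\<sigma> j) (p j) (q j)) =
      (\<Sum>S\<in>Pow {..<d}. (-1) ^ (d - card S) * (\<Prod>j<d. ?g S (p j) (q j)))" for p q
    using polarization[of d d "\<lambda>j. if p j = q j then z else 0" "\<lambda>l j. c l (p j) (q j)"]
    by (simp add: C_def)
  have "(\<Sum>t\<in>R. T r t * (\<Sum>\<sigma> | \<sigma> permutes {..<d}. \<Prod>j<d. c (\<sigma> j) (t j) (s j))) =
      (\<Sum>S\<in>Pow {..<d}. (-1) ^ (d - card S) * (\<Sum>t\<in>R. T r t * (\<Prod>j<d. ?g S (t j) (s j))))"
    unfolding pol sum_distrib_left by (subst sum.swap) (simp only: mult.left_commute)
  also have "\<dots> = (\<Sum>S\<in>Pow {..<d}. (-1) ^ (d - card S) * (\<Sum>t\<in>R. (\<Prod>j<d. ?g S (r j) (t j)) * T t s))"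
  proof (rule sum.cong[OF refl])
    fix S assume "S \<in> Pow {..<d}"
    then obtain h where "(?g S, h) \<in> units_commuting n B" using z by blast
    from comm[OF this rs] show "(-1) ^ (d - card S) * (\<Sum>t\<in>R. T r t * (\<Prod>j<d. ?g S (t j) (s j))) =
      (-1) ^ (d - card S) * (\<Sum>t\<in>R. (\<Prod>j<d. ?g S (r j) (t j)) * T t s)" by simp
  qed
  also have "\<dots> = (\<Sum>t\<in>R. (\<Sum>\<sigma> | \<sigma> permutes {..<d}. \<Prod>j<d. c (\<sigma> j) (r j) (t j)) * T t s)"
    unfolding pol sum_distrib_left sum_distrib_right by (subst sum.swap) (simp only: mult.assoc)
  finally show ?thesis .
qed

section \<open>The commutant of the units of the centralizer\<close>

lemma mat_fun_add:
  "M \<in> carrier_mat n n \<Longrightarrow> N \<in> carrier_mat n n \<Longrightarrow> mat_fun n (M + N) = mat_fun n M + mat_fun n N"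
  by (intro ext) (auto simp: mat_fun_def)

lemma mat_fun_smult: "M \<in> carrier_mat n n \<Longrightarrow> mat_fun n (c \<cdot>\<^sub>m M) = scale2 c (mat_fun n M)"
  by (intro ext) (auto simp: mat_fun_def)

lemma mat_fun_zero: "mat_fun n (0\<^sub>m n n) = 0"
  by (intro ext) (auto simp: mat_fun_def)

lemma mat_fun_mult:
  assumes "M \<in> carrier_mat n n" "N \<in> carrier_mat n n"
  shows "mat_fun n (M * N) = mmul n (mat_fun n M) (mat_fun n N)"
proof (intro ext)
  fix r s
  show "mat_fun n (M * N) r s = mmul n (mat_fun n M) (mat_fun n N) r s"
  proof (cases "r < n \<and> s < n")
    case True
    then show ?thesis
      using assms by (auto simp: mat_fun_def mmul_def scalar_prod_def atLeast0LessThan)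
  next
    case False
    then show ?thesis by (auto simp: mat_fun_def mmul_def)
  qed
qed

lemma mat_fun_inj:
  assumes "M \<in> carrier_mat n n" "N \<in> carrier_mat n n" "mat_fun n M = mat_fun n N"
  shows "M = N"
proof (rule eq_matI)
  fix i j assume "i < dim_row N" "j < dim_col N"
  moreover have "mat_fun n M i j = mat_fun n N i j" by (simp only: assms(3))
  ultimately show "M $$ (i, j) = N $$ (i, j)"
    using assms(1,2) by (simp add: mat_fun_def)
qed (use assms in auto)

lemma mmul_assoc: "mmul n (mmul n x y) z = mmul n x (mmul n y z)"
  unfolding mmul_def sum_distrib_left sum_distrib_right
  by (intro ext) (subst sum.swap, simp add: mult.assoc)

lemma bilinear_algebra_mmul: "bilinear_algebra scale2 (mmul n :: _ \<Rightarrow> _ \<Rightarrow> _ \<Rightarrow> _ \<Rightarrow> 'a::field_char_0)"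
proof (intro bilinear_algebra.intro bilinear_algebra_axioms.intro)
  show "vector_space (scale2 :: 'a \<Rightarrow> (nat \<Rightarrow> nat \<Rightarrow> 'a) \<Rightarrow> _)" by (rule kernel.vector_space_axioms)
  show "mmul n (mmul n x y) z = mmul n x (mmul n y z)" for x y z :: "nat \<Rightarrow> nat \<Rightarrow> 'a"
    by (rule mmul_assoc)
qed (auto simp: fun_eq_iff mmul_def algebra_simps sum.distrib sum_distrib_left)

text \<open>Carries \<open>A\<close> over to functions by \<open>mat_fun\<close>, where the
  separability result applies, and feeds the idempotent to \<open>tensor_double_centralizer\<close>.
  \<open>T\<close> is cut off outside the multi-indices because the spanning tensors vanish
  there.\<close>

lemma commutant_of_centralizer_units:
  fixes A :: "'a::field_char_0 mat set"
  assumes ss: "semisimple_subalgebra n A"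
    and comm: "\<And>g h r s. (g, h) \<in> units_commuting n (mat_fun n ` A) \<Longrightarrow>
      r \<in> multi_indices n d \<Longrightarrow> s \<in> multi_indices n d \<Longrightarrow>
      (\<Sum>t\<in>multi_indices n d. T r t * (\<Prod>j<d. g (t j) (s j))) =
      (\<Sum>t\<in>multi_indices n d. (\<Prod>j<d. g (r j) (t j)) * T t s)"
  shows "(\<lambda>r s. if r \<in> multi_indices n d \<and> s \<in> multi_indices n d then T r s else 0) \<in>
    kernel.span {tensor_perm n d \<sigma> a |\<sigma> a. \<sigma> permutes {..<d} \<and> (\<forall>j<d. a j \<in> mat_fun n ` A)}"
proof -
  let ?B = "mat_fun n ` A"
  have A: "A \<subseteq> carrier_mat n n" "0\<^sub>m n n \<in> A" "1\<^sub>m n \<in> A"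
    "\<And>a b. a \<in> A \<Longrightarrow> b \<in> A \<Longrightarrow> a + b \<in> A" "\<And>a b. a \<in> A \<Longrightarrow> b \<in> A \<Longrightarrow> a * b \<in> A"
    "\<And>c a. a \<in> A \<Longrightarrow> c \<cdot>\<^sub>m a \<in> A"
    using ss unfolding semisimple_subalgebra_def unital_subalgebra_def by blast+
  have carrier: "a \<in> carrier_mat n n" if "a \<in> A" for a using that A(1) by blast
  have B_sub: "kernel.subspace ?B"
    unfolding kernel.subspace_def
  proof (intro conjI ballI allI)
    show "0 \<in> ?B" using A(2) mat_fun_zero[of n] by (metis imageI)
    show "x + y \<in> ?B" if "x \<in> ?B" "y \<in> ?B" for x y
      using that carrier A(4) by (auto simp flip: mat_fun_add)
    show "scale2 c x \<in> ?B" if "x \<in> ?B" for c x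
      using that carrier A(6) by (auto simp flip: mat_fun_smult)
  qed
  have B_mul: "mmul n x y \<in> ?B" if "x \<in> ?B" "y \<in> ?B" for x y
    using that carrier A(5) by (auto simp flip: mat_fun_mult)
  \<comment> \<open>The matrix units span the image of \<open>A\<close>, which makes every basis of
    it finite.\<close>
  define E :: "nat \<times> nat \<Rightarrow> nat \<Rightarrow> nat \<Rightarrow> 'a"
    where "E = (\<lambda>(i, j) r s. if r = i \<and> s = j then 1 else 0)"
  have span_E: "?B \<subseteq> kernel.span (E ` ({..<n} \<times> {..<n}))"
  proof (rule image_subsetI)
    fix M
    have "mat_fun n M r s = (\<Sum>p\<in>{..<n} \<times> {..<n}. scale2 (M $$ p) (E p)) r s" for r s
    proof -
      have "(\<Sum>p\<in>{..<n} \<times> {..<n}. scale2 (M $$ p) (E p)) r s =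
          (\<Sum>p\<in>{..<n} \<times> {..<n}. if p = (r, s) then M $$ p else 0)"
        unfolding sum_fun_apply by (intro sum.cong) (auto simp: E_def split: if_splits)
      then show ?thesis by (simp add: mat_fun_def)
    qed
    then have "mat_fun n M = (\<Sum>p\<in>{..<n} \<times> {..<n}. scale2 (M $$ p) (E p))"
      by (intro ext)
    also have "\<dots> \<in> kernel.span (E ` ({..<n} \<times> {..<n}))"
      by (intro kernel.span_sum kernel.span_scale kernel.span_base imageI)
    finally show "mat_fun n M \<in> kernel.span (E ` ({..<n} \<times> {..<n}))" .
  qed
  obtain U where U: "U \<subseteq> ?B" "kernel.independent U" "?B \<subseteq> kernel.span U"
    by (rule kernel.basis_exists)
  have U_fin: "finite U"
    using kernel.independent_span_bound[OF _ U(2), of "E ` ({..<n} \<times> {..<n})"] U(1) span_E by auto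
  interpret bilinear_algebra scale2 "mmul n :: _ \<Rightarrow> _ \<Rightarrow> _ \<Rightarrow> _ \<Rightarrow> 'a"
    by (rule bilinear_algebra_mmul)
  interpret unital_fd_algebra scale2 "mmul n" ?B "mat_fun n (1\<^sub>m n)" U
  proof unfold_locales
    show "mmul n (mat_fun n (1\<^sub>m n)) x = x" if "x \<in> ?B" for x
    proof -
      from that obtain M where M: "M \<in> A" "x = mat_fun n M" by blast
      show ?thesis
        unfolding M(2) mat_fun_mult[OF one_carrier_mat carrier[OF M(1)], symmetric] by (simp only: left_mult_one_mat[OF carrier[OF M(1)]])
    qed
    show "mmul n x (mat_fun n (1\<^sub>m n)) = x" if "x \<in> ?B" for x
    proof -
      from that obtain M where M: "M \<in> A" "x = mat_fun n M" by blast
      show ?thesis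
        unfolding M(2) mat_fun_mult[OF carrier[OF M(1)] one_carrier_mat, symmetric] by (simp only: right_mult_one_mat[OF carrier[OF M(1)]])
    qed
  qed (use B_sub B_mul A U U_fin in auto)
  \<comment> \<open>A square-zero ideal pulls back to an ideal of matrices that is nilpotent with
    exponent 2, and semisimplicity makes that zero.\<close>
  have no_ideal: "I \<subseteq> {0}"
    if I: "I \<subseteq> ?B" "kernel.subspace I"
      "\<And>a x. a \<in> ?B \<Longrightarrow> x \<in> I \<Longrightarrow> mmul n a x \<in> I \<and> mmul n x a \<in> I"
      "\<And>x y. x \<in> I \<Longrightarrow> y \<in> I \<Longrightarrow> mmul n x y = 0" for I
  proof -
    define I' where "I' = {M \<in> A. mat_fun n M \<in> I}"
    have I'A: "M \<in> A" "mat_fun n M \<in> I" if "M \<in> I'" for M using that by (auto simp: I'_def)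
    have "alg_ideal n A I'"
      unfolding alg_ideal_def
    proof (intro conjI ballI allI)
      show "I' \<subseteq> A" by (auto simp: I'_def)
      show "0\<^sub>m n n \<in> I'"
        using A(2) I(2) by (simp add: I'_def mat_fun_zero kernel.subspace_0)
      show "x + y \<in> I'" if "x \<in> I'" "y \<in> I'" for x y
        using I'A[OF that(1)] I'A[OF that(2)] A(4) carrier I(2)
        by (simp add: I'_def mat_fun_add kernel.subspace_add)
      show "c \<cdot>\<^sub>m x \<in> I'" if "x \<in> I'" for c x
        using I'A[OF that] A(6) carrier I(2)
        by (simp add: I'_def mat_fun_smult kernel.subspace_scale)
      show "a * x \<in> I'" "x * a \<in> I'" if "a \<in> A" "x \<in> I'" for a x
        using I'A[OF that(2)] that(1) A(5) carrier I(3)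
        by (simp_all add: I'_def mat_fun_mult)
    qed
    moreover have "nilpotent_ideal n I'"
      unfolding nilpotent_ideal_def
    proof (intro exI[of _ 2] conjI allI impI)
      fix xs assume xs: "length xs = 2" "set xs \<subseteq> I'"
      then obtain x y where xy: "xs = [x, y]" "x \<in> I'" "y \<in> I'"
        by (auto simp: numeral_2_eq_2 length_Suc_conv)
      have "x * y = 0\<^sub>m n n"
      proof (rule mat_fun_inj)
        show "mat_fun n (x * y) = mat_fun n (0\<^sub>m n n)"
          using I'A[OF xy(2)] I'A[OF xy(3)] carrier I(4) by (simp add: mat_fun_mult mat_fun_zero)
      qed (use carrier[OF A(5)[OF I'A(1)[OF xy(2)] I'A(1)[OF xy(3)]]] in auto)
      then show "foldr (*) xs (1\<^sub>m n) = 0\<^sub>m n n"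
        using xy(1) right_mult_one_mat[OF carrier[OF I'A(1)[OF xy(3)]]] by simp
    qed simp
    ultimately have I'_zero: "I' = {0\<^sub>m n n}" using ss unfolding semisimple_subalgebra_def by blast
    show ?thesis
    proof
      fix y assume y: "y \<in> I"
      then obtain M where M: "M \<in> A" "y = mat_fun n M" using I(1) by blast
      then have "M \<in> I'" using y by (simp add: I'_def)
      then show "y \<in> {0}" using I'_zero M(2) by (simp add: mat_fun_zero)
    qed
  qed
  obtain v c where v: "v ` U \<subseteq> ?B" "(\<Sum>u\<in>U. mmul n u (v u)) = mat_fun n (1\<^sub>m n)"
    and vc: "\<And>a u. a \<in> ?B \<Longrightarrow> u \<in> U \<Longrightarrow> mmul n a u = (\<Sum>w\<in>U. scale2 (c a w u) w)"
      "\<And>a w. a \<in> ?B \<Longrightarrow> w \<in> U \<Longrightarrow> mmul n (v w) a = (\<Sum>u\<in>U. scale2 (c a w u) (v u))"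
    using separability_idempotent[OF no_ideal] by blast
  show ?thesis
  proof (rule tensor_double_centralizer[where U = U and v = v])
    show "mmul n a b \<in> ?B" if "a \<in> ?B" "b \<in> ?B" for a b using that by (rule B_mul)
    show "(\<Sum>u\<in>U. mmul n u (v u) r s) = (if r = s then 1 else 0)" if "r < n" "s < n" for r s
      using fun_cong[OF fun_cong[OF v(2)], of r s] that by (simp add: sum_fun_apply mat_fun_def)
    \<comment> \<open>The inner indices \<open>x\<close> and \<open>y\<close> are spectators:
      \<open>a\<close> acts on the row of \<open>u\<close> or on the column of
      \<open>v u\<close>.\<close>
    show "mmul n a (\<lambda>r s. \<Sum>u\<in>U. u r x * v u y s) r s = mmul n (\<lambda>r s. \<Sum>u\<in>U. u r x * v u y s) a r s"
      if "a \<in> ?B" for a x y r s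
    proof -
      have "mmul n a (\<lambda>r s. \<Sum>u\<in>U. u r x * v u y s) r s = (\<Sum>u\<in>U. mmul n a u r x * v u y s)"
        unfolding mmul_def sum_distrib_left sum_distrib_right
        by (subst sum.swap) (simp only: mult.assoc)
      also have "\<dots> = (\<Sum>u\<in>U. \<Sum>w\<in>U. c a w u * w r x * v u y s)"
        using vc(1)[OF that] by (intro sum.cong refl) (simp add: sum_fun_apply sum_distrib_right)
      also have "\<dots> = (\<Sum>w\<in>U. \<Sum>u\<in>U. w r x * (c a w u * v u y s))"
        by (subst sum.swap) (simp only: mult_ac)
      also have "\<dots> = (\<Sum>w\<in>U. w r x * mmul n (v w) a y s)"
        using vc(2)[OF that] by (intro sum.cong refl) (simp add: sum_fun_apply sum_distrib_left)
      also have "\<dots> = mmul n (\<lambda>r s. \<Sum>u\<in>U. u r x * v u y s) a r s"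
        unfolding mmul_def sum_distrib_left sum_distrib_right
        by (subst sum.swap) (simp only: mult.assoc)
      finally show ?thesis .
    qed
  next
    fix c r s
    assume "\<And>j a r s. j < d \<Longrightarrow> a \<in> ?B \<Longrightarrow> r < n \<Longrightarrow> s < n \<Longrightarrow> mmul n a (c j) r s = mmul n (c j) a r s"
      and "r \<in> multi_indices n d" "s \<in> multi_indices n d"
    then show "(\<Sum>t\<in>multi_indices n d. T r t * (\<Sum>\<sigma> | \<sigma> permutes {..<d}. \<Prod>j<d. c (\<sigma> j) (t j) (s j))) =
      (\<Sum>t\<in>multi_indices n d. (\<Sum>\<sigma> | \<sigma> permutes {..<d}. \<Prod>j<d. c (\<sigma> j) (r j) (t j)) * T t s)"
      by (intro commutes_with_symmetric_tensors[where n = n and B = ?B] comm)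
  qed (use U U_fin v in auto)
qed

section \<open>Invariant polynomial functions\<close>

text \<open>A formal polynomial as a list of coefficients and words in the variables; it retains the
  degrees by which it is later split.\<close>

definition monomial_sum :: "('a::comm_ring_1 \<times> 'b list) list \<Rightarrow> ('b \<Rightarrow> 'a) \<Rightarrow> 'a" where
  "monomial_sum ms y = sum_list (map (\<lambda>(c, w). c * prod_list (map y w)) ms)"

definition entries :: "nat \<Rightarrow> nat \<Rightarrow> (nat \<times> nat \<times> nat) set" where
  "entries n k = {..<k} \<times> {..<n} \<times> {..<n}"

definition entry_of :: "(nat \<Rightarrow> 'a mat) \<Rightarrow> nat \<times> nat \<times> nat \<Rightarrow> 'a" where
  "entry_of x = (\<lambda>(i, r, s). x i $$ (r, s))"

lemma monomial_sum_Nil [simp]: "monomial_sum [] y = 0"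
  by (simp add: monomial_sum_def)

lemma monomial_sum_Cons: "monomial_sum ((c, w) # ms) y = c * prod_list (map y w) + monomial_sum ms y"
  by (simp add: monomial_sum_def)

lemma monomial_sum_append: "monomial_sum (ms @ ns) y = monomial_sum ms y + monomial_sum ns y"
  by (simp add: monomial_sum_def)

lemma monomial_sum_mult:
  "\<exists>ns. (\<forall>(c, w)\<in>set ns. \<exists>(c', w')\<in>set ms. \<exists>(c'', w'')\<in>set ls. w = w' @ w'') \<and>
    (\<forall>y. monomial_sum ns y = monomial_sum ms y * monomial_sum ls y)"
proof (induction ms)
  case Nil
  show ?case by (rule exI[of _ "[]"]) simp
next
  case (Cons m ms)
  obtain c w where m: "m = (c, w)" by (cases m)
  from Cons obtain ns where ns:
    "\<forall>(c, w)\<in>set ns. \<exists>(c', w')\<in>set ms. \<exists>(c'', w'')\<in>set ls. w = w' @ w''"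
    "\<And>y. monomial_sum ns y = monomial_sum ms y * monomial_sum ls y" by blast
  define ns' where "ns' = map (\<lambda>(c', w'). (c * c', w @ w')) ls"
  have "monomial_sum ns' y = c * prod_list (map y w) * monomial_sum ls y" for y
    unfolding ns'_def
    by (induction ls) (auto simp: monomial_sum_Cons algebra_simps)
  then have "\<forall>y. monomial_sum (ns' @ ns) y = monomial_sum (m # ms) y * monomial_sum ls y"
    by (simp add: m monomial_sum_append monomial_sum_Cons ns(2) distrib_right)
  moreover have "\<forall>(c, w)\<in>set (ns' @ ns). \<exists>(c', w')\<in>set (m # ms). \<exists>(c'', w'')\<in>set ls. w = w' @ w''"
  proof (rule ballI)
    fix p assume "p \<in> set (ns' @ ns)"
    then consider "p \<in> set ns'" | "p \<in> set ns" by auto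
    then show "case p of (c, w) \<Rightarrow> \<exists>(c', w')\<in>set (m # ms). \<exists>(c'', w'')\<in>set ls. w = w' @ w''"
    proof cases
      case 1
      then show ?thesis by (fastforce simp: ns'_def m)
    next
      case 2
      then show ?thesis using ns(1) by fastforce
    qed
  qed
  ultimately show ?case by blast
qed

lemma poly_funs_monomial_sum:
  assumes "f \<in> poly_funs n k"
  obtains ms where "\<forall>(c, w)\<in>set ms. set w \<subseteq> entries n k" "\<And>x. f x = monomial_sum ms (entry_of x)"
proof -
  from assms have "\<exists>ms. (\<forall>(c, w)\<in>set ms. set w \<subseteq> entries n k) \<and> (\<forall>x. f x = monomial_sum ms (entry_of x))"
  proof (induction rule: poly_funs.induct)
    case (coord i r s)
    then show ?case
      by (intro exI[of _ "[(1, [(i, r, s)])]"]) (auto simp: monomial_sum_def entry_of_def entries_def)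
  next
    case (const c)
    then show ?case by (intro exI[of _ "[(c, [])]"]) (auto simp: monomial_sum_def)
  next
    case (add f g)
    then obtain ms ls where "\<forall>(c, w)\<in>set ms. set w \<subseteq> entries n k" "\<forall>(c, w)\<in>set ls. set w \<subseteq> entries n k"
      "\<forall>x. f x = monomial_sum ms (entry_of x)" "\<forall>x. g x = monomial_sum ls (entry_of x)" by blast
    then show ?case by (intro exI[of _ "ms @ ls"]) (auto simp: monomial_sum_append)
  next
    case (mult f g)
    then obtain ms ls where *: "\<forall>(c, w)\<in>set ms. set w \<subseteq> entries n k" "\<forall>(c, w)\<in>set ls. set w \<subseteq> entries n k"
      "\<forall>x. f x = monomial_sum ms (entry_of x)" "\<forall>x. g x = monomial_sum ls (entry_of x)" by blast
    obtain ns where ns: "\<forall>(c, w)\<in>set ns. \<exists>(c', w')\<in>set ms. \<exists>(c'', w'')\<in>set ls. w = w' @ w''"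
      "\<forall>y. monomial_sum ns y = monomial_sum ms y * monomial_sum ls y"
      using monomial_sum_mult[of ms ls] by blast
    have "set w \<subseteq> entries n k" if "(c, w) \<in> set ns" for c w
    proof -
      from ns(1) that obtain c' w' c'' w'' where "(c', w') \<in> set ms" "(c'', w'') \<in> set ls" "w = w' @ w''"
        by blast
      then show ?thesis using *(1,2) by fastforce
    qed
    then show ?case using ns(2) * by (intro exI[of _ ns]) auto
  qed
  then show ?thesis using that by blast
qed

lemma monomial_sum_cong:
  assumes "\<forall>(c, w)\<in>set ms. set w \<subseteq> E" "\<And>e. e \<in> E \<Longrightarrow> y e = z e"
  shows "monomial_sum ms y = monomial_sum ms z"
  unfolding monomial_sum_def
proof (intro arg_cong[where f = sum_list] map_cong refl)
  fix p assume p: "p \<in> set ms"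
  obtain c w where cw: "p = (c, w)" by (cases p)
  then have "map y w = map z w" using assms p by fastforce
  then show "(case p of (c, w) \<Rightarrow> c * prod_list (map y w)) = (case p of (c, w) \<Rightarrow> c * prod_list (map z w))"
    by (simp only: cw case_prod_conv)
qed

section \<open>Full polarization and its coefficients on matrix units\<close>

definition polar :: "nat \<Rightarrow> (('b \<Rightarrow> 'a::comm_ring_1) \<Rightarrow> 'a) \<Rightarrow> (nat \<Rightarrow> 'b \<Rightarrow> 'a) \<Rightarrow> 'a" where
  "polar d \<phi> X = (\<Sum>S\<in>Pow {..<d}. (-1) ^ (d - card S) * \<phi> (\<lambda>e. \<Sum>l\<in>S. X l e))"

text \<open>This is \<open>polarization\<close> with \<open>z = 0\<close> on each monomial: lower
  degrees die, and degree \<open>d\<close> becomes a symmetric multilinear expression.\<close>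

lemma polar_monomial_sum:
  assumes "\<forall>(c, w)\<in>set ms. length w \<le> d"
  shows "polar d (monomial_sum ms) X =
    (\<Sum>(c, w)\<leftarrow>filter (\<lambda>(c, w). length w = d) ms. c * (\<Sum>\<sigma> | \<sigma> permutes {..<d}. \<Prod>j<d. X (\<sigma> j) (w ! j)))"
  using assms
proof (induction ms)
  case Nil
  show ?case by (simp add: polar_def)
next
  case (Cons m ms)
  obtain c w where m: "m = (c, w)" by (cases m)
  have "(\<Sum>S\<in>Pow {..<d}. (-1) ^ (d - card S) * prod_list (map (\<lambda>e. \<Sum>l\<in>S. X l e) w)) =
      (if length w = d then \<Sum>\<sigma> | \<sigma> permutes {..<d}. \<Prod>j<d. X (\<sigma> j) (w ! j) else 0)"
    using polarization[of "length w" d "\<lambda>_. 0" "\<lambda>l j. X l (w ! j)"] Cons.prems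
    by (simp add: m prod.list_conv_set_nth atLeast0LessThan)
  moreover have "polar d (monomial_sum (m # ms)) X =
      c * (\<Sum>S\<in>Pow {..<d}. (-1) ^ (d - card S) * prod_list (map (\<lambda>e. \<Sum>l\<in>S. X l e) w)) +
      polar d (monomial_sum ms) X"
    by (simp add: polar_def m monomial_sum_Cons sum.distrib sum_distrib_left algebra_simps)
  ultimately show ?case
    using Cons by (simp add: m)
qed

text \<open>With equal arguments all \<open>d!\<close> permutations contribute the same product, so
  the leading form is recovered up to the factor \<open>d!\<close>.\<close>

lemma polar_diagonal:
  assumes "\<forall>(c, w)\<in>set ms. length w \<le> d"
  shows "polar d (monomial_sum ms) (\<lambda>_. y) = fact d * monomial_sum (filter (\<lambda>(c, w). length w = d) ms) y"
proof -
  let ?L = "filter (\<lambda>(c, w). length w = d) ms"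
  have "(\<Sum>(c, w)\<leftarrow>L. c * (\<Sum>\<sigma> | \<sigma> permutes {..<d}. \<Prod>j<d. y (w ! j))) = fact d * monomial_sum L y"
    if "\<forall>(c, w)\<in>set L. length w = d" for L
    using that
    by (induction L)
      (auto simp: monomial_sum_Cons prod.list_conv_set_nth atLeast0LessThan card_permutations[of "{..<d}" d]
        algebra_simps)
  from this[of ?L] show ?thesis by (auto simp: polar_monomial_sum[OF assms])
qed

text \<open>Argument \<open>l\<close> is the tuple whose matrix number \<open>i l\<close> is the
  matrix unit with row \<open>s l\<close> and column \<open>r l\<close>, all others being zero. In
  this order a coefficient at \<open>r\<close>, \<open>s\<close> meets the entry at
  \<open>s\<close>, \<open>r\<close>, so the expansion below is a trace.\<close>

definition unit_entries :: "(nat \<Rightarrow> nat) \<Rightarrow> (nat \<Rightarrow> nat) \<Rightarrow> (nat \<Rightarrow> nat) \<Rightarrow> nat \<Rightarrow> nat \<times> nat \<times> nat \<Rightarrow> 'a::comm_ring_1" where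
  "unit_entries i s r l e = (if e = (i l, s l, r l) then 1 else 0)"

text \<open>Multilinear expansion of one permuted monomial. Reindexing by the inverse permutation
  attaches to each argument \<open>X l\<close> the single entry at which it is evaluated.\<close>

lemma prod_expand_entries:
  fixes X :: "nat \<Rightarrow> nat \<times> nat \<times> nat \<Rightarrow> 'a::comm_ring_1"
  assumes \<sigma>: "\<sigma> permutes {..<d}" and w: "length w = d" "set w \<subseteq> entries n k"
  shows "(\<Prod>j<d. X (\<sigma> j) (w ! j)) =
    (\<Sum>i\<in>multi_indices k d. \<Sum>s\<in>multi_indices n d. \<Sum>r\<in>multi_indices n d.
      (\<Prod>j<d. unit_entries i s r (\<sigma> j) (w ! j)) * (\<Prod>l<d. X l (i l, s l, r l)))"
proof -
  define \<tau> where "\<tau> = inv_into UNIV \<sigma>"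
  have \<tau>: "\<tau> permutes {..<d}" unfolding \<tau>_def by (rule permutes_inv[OF \<sigma>])
  have reindex: "(\<Prod>j<d. Z (\<sigma> j) (w ! j)) = (\<Prod>l<d. Z l (w ! \<tau> l))"
    for Z :: "nat \<Rightarrow> nat \<times> nat \<times> nat \<Rightarrow> 'a"
    using prod_permute[OF \<sigma>, of "\<lambda>l. Z l (w ! \<tau> l)"] by (simp add: \<tau>_def permutes_inverses(2)[OF \<sigma>])
  have one: "X l (w ! \<tau> l) = (\<Sum>i<k. \<Sum>s<n. \<Sum>r<n. (if w ! \<tau> l = (i, s, r) then 1 else 0) * X l (i, s, r))"
    if "l < d" for l
  proof -
    have "w ! \<tau> l \<in> set w" using w(1) perm_less[OF \<tau> that] by simp
    then have "w ! \<tau> l \<in> entries n k" using w(2) by blast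
    then obtain i s r where irs: "w ! \<tau> l = (i, s, r)" "i < k" "s < n" "r < n"
      by (auto simp: entries_def)
    have "(if w ! \<tau> l = (i', s', r') then 1 else 0) * X l (i', s', r') =
        (if r' = r then if s' = s then if i' = i then X l (w ! \<tau> l) else 0 else 0 else 0)" for i' s' r'
      by (auto simp: irs(1))
    then show ?thesis using irs(2-4) by simp
  qed
  have "(\<Prod>j<d. X (\<sigma> j) (w ! j)) = (\<Prod>l<d. X l (w ! \<tau> l))" by (rule reindex)
  also have "\<dots> = (\<Prod>l<d. \<Sum>i<k. \<Sum>s<n. \<Sum>r<n. (if w ! \<tau> l = (i, s, r) then 1 else 0) * X l (i, s, r))"
    using one by (intro prod.cong) auto
  also have "\<dots> = (\<Sum>i\<in>multi_indices k d. \<Prod>l<d. \<Sum>s<n. \<Sum>r<n.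
      (if w ! \<tau> l = (i l, s, r) then 1 else 0) * X l (i l, s, r))"
    by (rule sum_multi_indices_prod[symmetric])
  also have "\<dots> = (\<Sum>i\<in>multi_indices k d. \<Sum>s\<in>multi_indices n d. \<Prod>l<d. \<Sum>r<n.
      (if w ! \<tau> l = (i l, s l, r) then 1 else 0) * X l (i l, s l, r))"
    by (intro sum.cong refl sum_multi_indices_prod[symmetric])
  also have "\<dots> = (\<Sum>i\<in>multi_indices k d. \<Sum>s\<in>multi_indices n d. \<Sum>r\<in>multi_indices n d.
      \<Prod>l<d. unit_entries i s r l (w ! \<tau> l) * X l (i l, s l, r l))"
    unfolding unit_entries_def by (intro sum.cong refl sum_multi_indices_prod[symmetric])
  finally show ?thesis by (simp only: prod.distrib reindex)
qed

lemma polar_expand_entries: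
  fixes X :: "nat \<Rightarrow> nat \<times> nat \<times> nat \<Rightarrow> 'a::comm_ring_1"
  assumes ms: "\<forall>(c, w)\<in>set ms. length w \<le> d \<and> set w \<subseteq> entries n k"
  shows "polar d (monomial_sum ms) X =
    (\<Sum>i\<in>multi_indices k d. \<Sum>s\<in>multi_indices n d. \<Sum>r\<in>multi_indices n d.
      polar d (monomial_sum ms) (unit_entries i s r) * (\<Prod>l<d. X l (i l, s l, r l)))"
proof -
  let ?S = "{\<sigma>. \<sigma> permutes {..<d}}" and ?I = "multi_indices k d" and ?N = "multi_indices n d"
  have *: "c * (\<Sum>\<sigma>\<in>?S. \<Prod>j<d. X (\<sigma> j) (w ! j)) =
      (\<Sum>i\<in>?I. \<Sum>s\<in>?N. \<Sum>r\<in>?N.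
        c * (\<Sum>\<sigma>\<in>?S. \<Prod>j<d. unit_entries i s r (\<sigma> j) (w ! j)) * (\<Prod>l<d. X l (i l, s l, r l)))"
    if "length w = d" "set w \<subseteq> entries n k" for c w
  proof -
    have "(\<Sum>\<sigma>\<in>?S. \<Prod>j<d. X (\<sigma> j) (w ! j)) = (\<Sum>\<sigma>\<in>?S. \<Sum>i\<in>?I. \<Sum>s\<in>?N. \<Sum>r\<in>?N.
        (\<Prod>j<d. unit_entries i s r (\<sigma> j) (w ! j)) * (\<Prod>l<d. X l (i l, s l, r l)))"
      using that by (intro sum.cong refl prod_expand_entries) auto
    also have "\<dots> = (\<Sum>i\<in>?I. \<Sum>s\<in>?N. \<Sum>r\<in>?N. \<Sum>\<sigma>\<in>?S.
        (\<Prod>j<d. unit_entries i s r (\<sigma> j) (w ! j)) * (\<Prod>l<d. X l (i l, s l, r l)))"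
      by (simp only: sum.swap[of _ _ ?S])
    finally show ?thesis by (simp only: sum_distrib_left sum_distrib_right mult.assoc)
  qed
  have "(\<Sum>(c, w)\<leftarrow>L. c * (\<Sum>\<sigma>\<in>?S. \<Prod>j<d. X (\<sigma> j) (w ! j))) =
      (\<Sum>i\<in>?I. \<Sum>s\<in>?N. \<Sum>r\<in>?N.
        (\<Sum>(c, w)\<leftarrow>L. c * (\<Sum>\<sigma>\<in>?S. \<Prod>j<d. unit_entries i s r (\<sigma> j) (w ! j))) * (\<Prod>l<d. X l (i l, s l, r l)))"
    if "\<forall>(c, w)\<in>set L. length w = d \<and> set w \<subseteq> entries n k" for L
    using that
  proof (induction L)
    case (Cons m L)
    obtain c w where m: "m = (c, w)" by (cases m)
    with Cons.prems have w: "length w = d" "set w \<subseteq> entries n k" by auto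
    show ?case
      using Cons.IH Cons.prems by (simp add: m *[OF w] distrib_right sum.distrib)
  qed simp
  moreover have "\<forall>(c, w)\<in>set (filter (\<lambda>(c, w). length w = d) ms). length w = d \<and> set w \<subseteq> entries n k"
    using ms by auto
  moreover have "\<forall>(c, w)\<in>set ms. length w \<le> d" using ms by auto
  ultimately show ?thesis by (simp only: polar_monomial_sum)
qed

definition conj_entries :: "nat \<Rightarrow> (nat \<Rightarrow> nat \<Rightarrow> 'a::comm_ring_1) \<Rightarrow> (nat \<Rightarrow> nat \<Rightarrow> 'a) \<Rightarrow>
    (nat \<times> nat \<times> nat \<Rightarrow> 'a) \<Rightarrow> nat \<times> nat \<times> nat \<Rightarrow> 'a" where
  "conj_entries n g h y = (\<lambda>(i, r, s). \<Sum>p<n. \<Sum>q<n. g r p * y (i, p, q) * h q s)"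

text \<open>Stated for functions of entry labels rather than matrix tuples, so that arguments add
  pointwise and \<open>polar\<close> applies directly.\<close>

definition conj_invariant :: "nat \<Rightarrow> (nat \<Rightarrow> nat \<Rightarrow> 'a::field) set \<Rightarrow> ((nat \<times> nat \<times> nat \<Rightarrow> 'a) \<Rightarrow> 'a) \<Rightarrow> bool" where
  "conj_invariant n B \<phi> \<longleftrightarrow> (\<forall>(g, h)\<in>units_commuting n B. \<forall>y. \<phi> (conj_entries n g h y) = \<phi> y)"

text \<open>Conjugation by a fixed unit is linear, hence commutes with the partial sums in
  \<open>polar\<close>; invariance passes to the polarization without a look at the
  monomials.\<close>

lemma polar_conj_entries:
  assumes "conj_invariant n B \<phi>" "(g, h) \<in> units_commuting n B"
  shows "polar d \<phi> (\<lambda>l. conj_entries n g h (X l)) = polar d \<phi> X"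
proof -
  have "(\<lambda>e. \<Sum>l\<in>S. conj_entries n g h (X l) e) = conj_entries n g h (\<lambda>e. \<Sum>l\<in>S. X l e)" for S
  proof
    fix e :: "nat \<times> nat \<times> nat"
    obtain i r s where e: "e = (i, r, s)" by (cases e)
    have "(\<Sum>l\<in>S. \<Sum>p<n. \<Sum>q<n. g r p * X l (i, p, q) * h q s) =
        (\<Sum>p<n. \<Sum>q<n. \<Sum>l\<in>S. g r p * X l (i, p, q) * h q s)"
      by (simp only: sum.swap[of _ _ S])
    then show "(\<Sum>l\<in>S. conj_entries n g h (X l) e) = conj_entries n g h (\<lambda>e. \<Sum>l\<in>S. X l e) e"
      by (simp add: conj_entries_def e sum_distrib_left sum_distrib_right)
  qed
  then show ?thesis
    using assms by (auto simp: polar_def conj_invariant_def)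
qed

lemma prod_delta_multi_indices:
  assumes "r \<in> multi_indices n d" "s \<in> multi_indices n d"
  shows "(\<Prod>l<d. if r l = s l then 1 else 0) = (if r = s then 1 else (0::'a::comm_ring_1))"
proof (cases "r = s")
  case False
  then obtain l where "l < d" "r l \<noteq> s l"
    using assms PiE_ext[of r "{..<d}" "\<lambda>_. {..<n}" s] by (auto simp: multi_indices_def)
  then show ?thesis using False by (intro trans[OF prod_zero]) auto
qed simp

text \<open>The components of the full polarization, as operators on the tensor power, commute with
  \<open>g \<otimes> \<dots> \<otimes> g\<close>: conjugating the arguments \<open>E\<^sub>s\<^sub>r g\<close> by \<open>g\<close> turns them into \<open>g E\<^sub>s\<^sub>r\<close>.\<close>
lemma polar_commutes_with_units:
  fixes ms :: "('a::field_char_0 \<times> (nat \<times> nat \<times> nat) list) list"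
  assumes ms: "\<forall>(c, w)\<in>set ms. length w \<le> d \<and> set w \<subseteq> entries n k"
    and inv: "conj_invariant n B (monomial_sum ms)" and gh: "(g, h) \<in> units_commuting n B"
    and i: "i \<in> multi_indices k d" and r: "r \<in> multi_indices n d" and s: "s \<in> multi_indices n d"
  defines "T \<equiv> \<lambda>r s. polar d (monomial_sum ms) (unit_entries i s r)"
  shows "(\<Sum>t\<in>multi_indices n d. T r t * (\<Prod>j<d. g (t j) (s j))) =
    (\<Sum>t\<in>multi_indices n d. (\<Prod>j<d. g (r j) (t j)) * T t s)"
proof -
  let ?N = "multi_indices n d"
  let ?\<phi> = "polar d (monomial_sum ms)"
  \<comment> \<open>Arguments whose \<open>l\<close>-th tuple lives in matrix number
    \<open>i l\<close> alone isolate the component of the polarization at \<open>i\<close>, whose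
    operator is \<open>T\<close>.\<close>
  have polar_i: "?\<phi> X = (\<Sum>s\<in>?N. \<Sum>r\<in>?N. T r s * (\<Prod>l<d. Z l (s l) (r l)))"
    if X: "\<And>l i' p q. l < d \<Longrightarrow> p < n \<Longrightarrow> q < n \<Longrightarrow> X l (i', p, q) = (if i' = i l then Z l p q else 0)" for X Z
  proof -
    have "(\<Sum>s\<in>?N. \<Sum>r\<in>?N. ?\<phi> (unit_entries i' s r) * (\<Prod>l<d. X l (i' l, s l, r l))) =
        (if i' = i then \<Sum>s\<in>?N. \<Sum>r\<in>?N. T r s * (\<Prod>l<d. Z l (s l) (r l)) else 0)"
      if i': "i' \<in> multi_indices k d" for i'
    proof -
      have "(\<Prod>l<d. X l (i' l, s l, r l)) = (if i' = i then \<Prod>l<d. Z l (s l) (r l) else 0)"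
        if "s \<in> ?N" "r \<in> ?N" for s r
      proof -
        have "(\<Prod>l<d. X l (i' l, s l, r l)) = (\<Prod>l<d. (if i' l = i l then 1 else 0) * Z l (s l) (r l))"
          using that by (intro prod.cong refl) (auto simp: X multi_indices_less)
        then show ?thesis by (simp add: prod.distrib prod_delta_multi_indices[OF i' i])
      qed
      then have "(\<Sum>s\<in>?N. \<Sum>r\<in>?N. ?\<phi> (unit_entries i' s r) * (\<Prod>l<d. X l (i' l, s l, r l))) =
        (\<Sum>s\<in>?N. \<Sum>r\<in>?N. ?\<phi> (unit_entries i' s r) * (if i' = i then \<Prod>l<d. Z l (s l) (r l) else 0))"
        by (intro sum.cong refl) simp
      then show ?thesis by (simp add: T_def)
    qed
    then have "?\<phi> X = (\<Sum>i'\<in>multi_indices k d.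
        if i' = i then \<Sum>s\<in>?N. \<Sum>r\<in>?N. T r s * (\<Prod>l<d. Z l (s l) (r l)) else 0)"
      by (subst polar_expand_entries[OF ms]) (intro sum.cong refl)
    then show ?thesis using i by simp
  qed
  \<comment> \<open>With \<open>E\<close> the matrix unit at row \<open>s l\<close> and column
    \<open>r l\<close> of matrix number \<open>i l\<close>, these are \<open>g E\<close> and
    \<open>E g\<close>.\<close>
  define X where "X l = (\<lambda>(i', p, q). if i' = i l then g p (s l) * (if q = r l then 1 else 0) else 0)" for l
  define Y where "Y l = (\<lambda>(i', p, q). if i' = i l then (if p = s l then 1 else 0) * g (r l) q else 0)" for l
  have "(\<Sum>t\<in>?N. T r t * (\<Prod>j<d. g (t j) (s j))) =
      (\<Sum>t\<in>?N. \<Sum>r'\<in>?N. T r' t * (\<Prod>l<d. g (t l) (s l) * (if r' l = r l then 1 else 0)))"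
  proof (rule sum.cong[OF refl])
    fix t assume "t \<in> ?N"
    have "(\<Sum>r'\<in>?N. T r' t * (\<Prod>l<d. g (t l) (s l) * (if r' l = r l then 1 else 0))) =
        (\<Sum>r'\<in>?N. if r' = r then T r' t * (\<Prod>l<d. g (t l) (s l)) else 0)"
      using r by (intro sum.cong refl) (simp add: prod.distrib prod_delta_multi_indices)
    then show "T r t * (\<Prod>j<d. g (t j) (s j)) =
        (\<Sum>r'\<in>?N. T r' t * (\<Prod>l<d. g (t l) (s l) * (if r' l = r l then 1 else 0)))"
      using r by simp
  qed
  also have "\<dots> = ?\<phi> (\<lambda>l. conj_entries n g h (Y l))"
  proof (rule polar_i[symmetric])
    fix l i' p q assume l: "l < d" "p < n" "q < n"
    then have sr: "s l < n" "r l < n" using r s by (auto simp: multi_indices_less)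
    have gh1: "(\<Sum>b<n. g (r l) b * h b q) = (if q = r l then 1 else 0)"
      using gh l sr by (auto simp: units_commuting_def mmul_def)
    have "(\<Sum>b<n. g p a * ((if a = s l then 1 else 0) * g (r l) b) * h b q) =
        (if a = s l then g p a * (\<Sum>b<n. g (r l) b * h b q) else 0)" for a
      by (simp add: sum_distrib_left mult.assoc)
    then show "conj_entries n g h (Y l) (i', p, q) =
        (if i' = i l then g p (s l) * (if q = r l then 1 else 0) else 0)"
      using sr by (simp add: conj_entries_def Y_def gh1)
  qed
  also have "\<dots> = ?\<phi> Y" by (rule polar_conj_entries[OF inv gh])
  also have "\<dots> = (\<Sum>s'\<in>?N. \<Sum>r'\<in>?N. T r' s' * (\<Prod>l<d. (if s' l = s l then 1 else 0) * g (r l) (r' l)))"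
    by (rule polar_i) (simp add: Y_def)
  also have "\<dots> = (\<Sum>s'\<in>?N. if s' = s then \<Sum>r'\<in>?N. (\<Prod>l<d. g (r l) (r' l)) * T r' s' else 0)"
    using s by (intro sum.cong refl) (simp add: prod.distrib prod_delta_multi_indices mult.commute)
  also have "\<dots> = (\<Sum>t\<in>?N. (\<Prod>j<d. g (r j) (t j)) * T t s)"
    using s by simp
  finally show ?thesis .
qed

text \<open>Grouped by the choice \<open>i\<close> of matrix for each argument, the diagonal of the
  polarization is a sum of traces of operators \<open>T i\<close> against tensors of the
  \<open>x (i j)\<close>. Each \<open>T i\<close> commutes with the units, so it lies in the span of
  permuted tensors from \<open>A\<close>.\<close>

lemma pure_on_polar:
  fixes A :: "'a::field_char_0 mat set"
  assumes ss: "semisimple_subalgebra n A"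
    and ms: "\<forall>(c, w)\<in>set ms. length w \<le> d \<and> set w \<subseteq> entries n k"
    and inv: "conj_invariant n (mat_fun n ` A) (monomial_sum ms)"
  shows "pure_on n k A (\<lambda>x. polar d (monomial_sum ms) (\<lambda>_. entry_of x))"
proof -
  let ?N = "multi_indices n d"
  define T where "T i r s = polar d (monomial_sum ms) (unit_entries i s r)" for i r s
  have A: "A \<subseteq> carrier_mat n n"
    using ss by (simp add: semisimple_subalgebra_def unital_subalgebra_def)
  have pure_i: "pure_on n k A (\<lambda>x. \<Sum>r\<in>?N. \<Sum>s\<in>?N.
      (if r \<in> ?N \<and> s \<in> ?N then T i r s else 0) * (\<Prod>j<d. x (i j) $$ (s j, r j)))"
    if i: "i \<in> multi_indices k d" for i
  proof (rule pure_on_span_tensor_perm[OF _ A])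
    show "(\<lambda>r s. if r \<in> ?N \<and> s \<in> ?N then T i r s else 0) \<in>
        kernel.span {tensor_perm n d \<sigma> a |\<sigma> a. \<sigma> permutes {..<d} \<and> (\<forall>j<d. a j \<in> mat_fun n ` A)}"
      unfolding T_def
      by (rule commutant_of_centralizer_units[OF ss]) (rule polar_commutes_with_units[OF ms inv _ i])
    show "i j < k" if "j < d" for j using multi_indices_less[OF i that] .
  qed
  have "pure_on n k A (\<lambda>x. \<Sum>i\<in>multi_indices k d. \<Sum>r\<in>?N. \<Sum>s\<in>?N.
      (if r \<in> ?N \<and> s \<in> ?N then T i r s else 0) * (\<Prod>j<d. x (i j) $$ (s j, r j)))"
    by (rule pure_on_sum[OF pure_i])
  then show ?thesis
  proof (rule pure_on_cong)
    fix x :: "nat \<Rightarrow> 'a mat"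
    have "polar d (monomial_sum ms) (\<lambda>_. entry_of x) =
        (\<Sum>i\<in>multi_indices k d. \<Sum>s\<in>?N. \<Sum>r\<in>?N. T i r s * (\<Prod>j<d. x (i j) $$ (s j, r j)))"
      by (subst polar_expand_entries[OF ms]) (simp add: T_def entry_of_def)
    also have "\<dots> = (\<Sum>i\<in>multi_indices k d. \<Sum>r\<in>?N. \<Sum>s\<in>?N. T i r s * (\<Prod>j<d. x (i j) $$ (s j, r j)))"
      by (intro sum.cong refl sum.swap)
    also have "\<dots> = (\<Sum>i\<in>multi_indices k d. \<Sum>r\<in>?N. \<Sum>s\<in>?N.
      (if r \<in> ?N \<and> s \<in> ?N then T i r s else 0) * (\<Prod>j<d. x (i j) $$ (s j, r j)))"
      by (intro sum.cong refl) simp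
    finally show "polar d (monomial_sum ms) (\<lambda>_. entry_of x) = \<dots>" .
  qed
qed

text \<open>The strict bound \<open>D\<close> makes the empty list the base case. The leading form
  inherits invariance from its polarization, whose diagonal is \<open>d!\<close> times the form; the
  remainder is then invariant as well and has smaller degree.\<close>

lemma pure_on_monomial_sum:
  fixes A :: "'a::field_char_0 mat set"
  assumes ss: "semisimple_subalgebra n A"
    and "\<forall>(c, w)\<in>set ms. length w < D \<and> set w \<subseteq> entries n k"
    and "conj_invariant n (mat_fun n ` A) (monomial_sum ms)"
  shows "pure_on n k A (\<lambda>x. monomial_sum ms (entry_of x))"
  using assms(2,3)
proof (induction D arbitrary: ms)
  case 0
  then have "ms = []" by (cases ms) auto
  then show ?case by (simp add: pure_on_const)
next
  case (Suc d)
  let ?top = "filter (\<lambda>(c, w). length w = d) ms"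
  let ?low = "filter (\<lambda>p. \<not> (case p of (c, w) \<Rightarrow> length w = d)) ms"
  have ms: "\<forall>(c, w)\<in>set ms. length w \<le> d \<and> set w \<subseteq> entries n k"
    using Suc.prems(1) by auto
  have split: "monomial_sum ms y = monomial_sum ?top y + monomial_sum ?low y" for y :: "nat \<times> nat \<times> nat \<Rightarrow> 'a"
    unfolding monomial_sum_def by (induction ms) auto
  have diag: "polar d (monomial_sum ms) (\<lambda>_. y) = fact d * monomial_sum ?top y" for y :: "nat \<times> nat \<times> nat \<Rightarrow> 'a"
    using ms by (intro polar_diagonal) auto
  have top_inv: "monomial_sum ?top (conj_entries n g h y) = monomial_sum ?top y"
    if "(g, h) \<in> units_commuting n (mat_fun n ` A)" for g h y
  proof -
    have "fact d * monomial_sum ?top (conj_entries n g h y) = fact d * monomial_sum ?top y"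
      using polar_conj_entries[OF Suc.prems(2) that, of d "\<lambda>_. y"] by (simp only: diag)
    then show ?thesis by simp
  qed
  have "pure_on n k A (\<lambda>x. monomial_sum ?low (entry_of x))"
  proof (rule Suc.IH)
    show "\<forall>(c, w)\<in>set ?low. length w < d \<and> set w \<subseteq> entries n k"
      using ms by fastforce
    show "conj_invariant n (mat_fun n ` A) (monomial_sum ?low)"
      unfolding conj_invariant_def
    proof (intro ballI, clarify)
      fix g h y assume gh: "(g, h) \<in> units_commuting n (mat_fun n ` A)"
      have "monomial_sum ms (conj_entries n g h y) = monomial_sum ms y"
        using Suc.prems(2) gh by (auto simp: conj_invariant_def)
      then show "monomial_sum ?low (conj_entries n g h y) = monomial_sum ?low y"
        unfolding split top_inv[OF gh] by simp
    qed
  qed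
  moreover have "pure_on n k A (\<lambda>x. 1 / fact d * polar d (monomial_sum ms) (\<lambda>_. entry_of x))"
    by (intro pure_on_mult pure_on_const pure_on_polar ss ms Suc.prems(2))
  ultimately have "pure_on n k A (\<lambda>x. 1 / fact d * polar d (monomial_sum ms) (\<lambda>_. entry_of x) +
      monomial_sum ?low (entry_of x))"
    by (intro pure_on_add)
  then show ?case
    by (rule pure_on_cong) (simp only: split[of "entry_of _"] diag, simp)
qed

theorem theorem5p2:
  fixes A :: "'a::field_char_0 mat set" and n k :: nat
    and f :: "(nat \<Rightarrow> 'a mat) \<Rightarrow> 'a"
  assumes "semisimple_subalgebra n A"
    and "f \<in> poly_funs n k"
    and "\<And>g h x. g \<in> centralizer_units n A \<Longrightarrow> h \<in> carrier_mat n n \<Longrightarrow>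
           g * h = 1\<^sub>m n \<Longrightarrow> h * g = 1\<^sub>m n \<Longrightarrow> (\<forall>i<k. x i \<in> carrier_mat n n) \<Longrightarrow>
           f (\<lambda>i. g * x i * h) = f x"
  shows "\<exists>p \<in> pure_A_trace_polys n k A.
           \<forall>x. (\<forall>i<k. x i \<in> carrier_mat n n) \<longrightarrow> f x = p x"
proof -
  obtain ms where ms: "\<forall>(c, w)\<in>set ms. set w \<subseteq> entries n k" "\<And>x. f x = monomial_sum ms (entry_of x)"
    using poly_funs_monomial_sum[OF assms(2)] by blast
  have A: "A \<subseteq> carrier_mat n n"
    using assms(1) by (simp add: semisimple_subalgebra_def unital_subalgebra_def)
  have inv: "conj_invariant n (mat_fun n ` A) (monomial_sum ms)"
    unfolding conj_invariant_def
  proof (intro ballI, clarify)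
    fix g h :: "nat \<Rightarrow> nat \<Rightarrow> 'a" and y :: "nat \<times> nat \<times> nat \<Rightarrow> 'a"
    assume gh: "(g, h) \<in> units_commuting n (mat_fun n ` A)"
    define G where "G = mat n n (\<lambda>(r, s). g r s)"
    define H where "H = mat n n (\<lambda>(r, s). h r s)"
    \<comment> \<open>Whatever values \<open>y\<close> takes at the entries occurring in
      \<open>ms\<close>, they are entries of a matrix tuple, so invariance of \<open>f\<close> on
      matrices yields the formal invariance.\<close>
    define x where "x i = mat n n (\<lambda>(r, s). y (i, r, s))" for i
    have carrier: "G \<in> carrier_mat n n" "H \<in> carrier_mat n n" "x i \<in> carrier_mat n n" for i
      by (simp_all add: G_def H_def x_def)
    have GH: "G * H = 1\<^sub>m n" "H * G = 1\<^sub>m n"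
      using gh by (auto intro!: eq_matI simp: G_def H_def units_commuting_def mmul_mat simp del: index_mult_mat(1))
    have "G * a = a * G" if "a \<in> A" for a
    proof (rule mat_fun_inj)
      have a: "a \<in> carrier_mat n n" using that A by blast
      then show "G * a \<in> carrier_mat n n" "a * G \<in> carrier_mat n n" using carrier by auto
      have "mmul n (mat_fun n G) (mat_fun n a) r s = mmul n (mat_fun n a) (mat_fun n G) r s" for r s
      proof (cases "r < n \<and> s < n")
        case True
        have "mmul n (mat_fun n a) (mat_fun n G) r s = mmul n (mat_fun n a) g r s"
          "mmul n (mat_fun n G) (mat_fun n a) r s = mmul n g (mat_fun n a) r s"
          unfolding mmul_def using True by (auto intro!: sum.cong simp: mat_fun_def G_def)
        then show ?thesis using gh True that by (auto simp: units_commuting_def)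
      next
        case False
        then show ?thesis by (auto simp: mmul_def mat_fun_def)
      qed
      then show "mat_fun n (G * a) = mat_fun n (a * G)"
        using a carrier by (simp add: mat_fun_mult fun_eq_iff)
    qed
    moreover have "invertible_mat G"
      using GH carrier unfolding invertible_mat_def inverts_mat_def by auto
    ultimately have "G \<in> centralizer_units n A"
      using carrier by (simp add: centralizer_units_def)
    then have "f (\<lambda>i. G * x i * H) = f x"
      using assms(3) carrier GH by blast
    moreover have "f x = monomial_sum ms y"
      unfolding ms(2) by (rule monomial_sum_cong[OF ms(1)]) (auto simp: entries_def entry_of_def x_def)
    moreover have "f (\<lambda>i. G * x i * H) = monomial_sum ms (conj_entries n g h y)"
      unfolding ms(2)
    proof (rule monomial_sum_cong[OF ms(1)])
      fix e assume "e \<in> entries n k"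
      then obtain i r s where e: "e = (i, r, s)" "r < n" "s < n" by (auto simp: entries_def)
      have "(G * x i * H) $$ (r, s) = (\<Sum>q<n. (\<Sum>p<n. g r p * y (i, p, q)) * h q s)"
        using e by (simp add: G_def H_def x_def scalar_prod_def atLeast0LessThan)
      also have "\<dots> = (\<Sum>p<n. \<Sum>q<n. g r p * y (i, p, q) * h q s)"
        by (simp only: sum_distrib_right) (rule sum.swap)
      finally show "entry_of (\<lambda>i. G * x i * H) e = conj_entries n g h y e"
        by (simp add: entry_of_def conj_entries_def e)
    qed
    ultimately show "monomial_sum ms (conj_entries n g h y) = monomial_sum ms y" by simp
  qed
  \<comment> \<open>A strict bound on the degrees; inserting 0 keeps the maximum meaningful when
    \<open>ms\<close> is empty.\<close>
  define D where "D = Suc (Max (insert 0 ((length \<circ> snd) ` set ms)))"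
  have "length w < D" if "(c, w) \<in> set ms" for c w
    using that by (force simp: D_def less_Suc_eq_le intro: Max_ge)
  then have "pure_on n k A (\<lambda>x. monomial_sum ms (entry_of x))"
    using ms(1) by (intro pure_on_monomial_sum[OF assms(1) _ inv, of D]) fastforce
  then show ?thesis by (simp add: pure_on_def ms(2))
qed

end
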